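(* For a normed space $X$, the following conditions are equivalent: (a) $X$ admits a locally finite tiling by bounded convex bodies; (b) $X$ admits an equivalent norm that is (VI)-polyhedral and has property ($\Delta$); (c) $X$ admits an equivalent norm that is (K)-polyhedral and LFC. In this case, $X$ admits a locally finite tiling by (bounded) polytopes, with the property that one of the polytopes is symmetric with respect to the origin. Finally, if $X$ is infinite dimensional and $\|\cdot\|$ is a (VI)-polyhedral equivalent norm on $X$ with property ($\Delta$), the cardinality of the tiling can be taken to be equal to the cardinality of the minimal boundary of $(X,\|\cdot\|)$.
   Context: All normed spaces are real. For a normed space $X$, $B_X$ and $S_X$ denote its closed unit ball and unit sphere, and $X^*$ its topological dual. $\operatorname{ext} C$ is the set of extreme points of a convex set $C$. For $x\in S_X$ let $\mathcal D(x)=\{f\in S_{X^*}: f(x)=1\}$. A convex body is a closed convex set with non-empty interior. A tiling of $X$ is a collection of convex bodies that cover $X$ and have mutually disjoint interiors. A tiling is locally finite if each $x\in X$ has a neighbourhood that intersects only finitely many elements of the tiling. A closed, bounded convex set $C$ in $X$ is a polytope if its intersection with every finite-dimensional linear (equivalently, affine) subspace of $X$ is a finite-dimensional polytope, i.e. the convex hull of finitely many points. A norm has property ($\Delta$) if for every $x\in S_X$ the set $\operatorname{ext}\mathcal D(x)$ is finite. It is (K)-polyhedral if the unit ball of every finite-dimensional subspace of $X$ is a polytope. It is (VI)-polyhedral if every $x\in S_X$ has a neighbourhood $V$ such that for every $y\in V\cap S_X$ the segment $[x,y]$ is contained in $S_X$. A norm $\|\cdot\|$ is LFC if for each $x\in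 S_X$ there exist a neighbourhood $U$ of $x$ and functionals $f_1,\dots,f_n\in X^*$ such that $\|y\|=\|z\|$ for all $y,z\in U$ with $f_k(y)=f_k(z)$ for all $k=1,\dots,n$. A set $\mathcal B\subseteq B_{X^*}$ is a boundary for $X$ if for every $x\in S_X$ there is $f\in\mathcal B$ with $f(x)=1$. For $(X,\|\cdot\|)$ a (VI)-polyhedral normed space with property ($\Delta$), the minimal boundary is $\mathcal B_0=w^*\text{-}\exp(B_{X^*})$, the set of all $f\in B_{X^*}$ for which there is $x\in X$ with $g(x)<f(x)$ for all $g\in B_{X^*}$, $g\ne f$; for such spaces it is a boundary and it is contained in every boundary of $X$. It coincides with the set of $f\in S_{X^*}$ such that $f^{-1}(1)\cap B_X$ has non-empty interior relative to the hyperplane $f^{-1}(1)$. *)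

theory Defs
  imports "HOL-Analysis.Analysis"
begin

text \<open>The normed space is a type of class \<open>real_normed_vector\<close> (not necessarily complete).
  Renormings are functions \<open>N\<close> on that type. As an equivalent norm induces the same
  topology, the same bounded sets and the same continuous functionals, the topology
  and the dual \<open>'a \<Rightarrow>\<^sub>L real\<close> of the type are used throughout; only quantities that depend on
  the norm itself (sphere, balls, dual norm) refer to \<open>N\<close>.\<close>

definition equivalent_norm :: "('a::real_normed_vector \<Rightarrow> real) \<Rightarrow> bool" where
  "equivalent_norm N \<longleftrightarrow>
     (\<forall>x. 0 \<le> N x) \<and> (\<forall>x. N x = 0 \<longleftrightarrow> x = 0) \<and>
     (\<forall>x y. N (x + y) \<le> N x + N y) \<and> (\<forall>c x. N (c *\<^sub>R x) = \<bar>c\<bar> * N x) \<and>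
     (\<exists>m M. 0 < m \<and> 0 < M \<and> (\<forall>x. m * norm x \<le> N x \<and> N x \<le> M * norm x))"

definition unit_sphere :: "('a::real_normed_vector \<Rightarrow> real) \<Rightarrow> 'a set" where
  "unit_sphere N = {x. N x = 1}"

definition unit_ball :: "('a::real_normed_vector \<Rightarrow> real) \<Rightarrow> 'a set" where
  "unit_ball N = {x. N x \<le> 1}"

definition dual_norm :: "('a::real_normed_vector \<Rightarrow> real) \<Rightarrow> ('a \<Rightarrow>\<^sub>L real) \<Rightarrow> real" where
  "dual_norm N f = (SUP x\<in>unit_ball N. \<bar>blinfun_apply f x\<bar>)"

definition duality_set :: "('a::real_normed_vector \<Rightarrow> real) \<Rightarrow> 'a \<Rightarrow> ('a \<Rightarrow>\<^sub>L real) set" where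
  "duality_set N x = {f. dual_norm N f = 1 \<and> blinfun_apply f x = 1}"

definition property_Delta :: "('a::real_normed_vector \<Rightarrow> real) \<Rightarrow> bool" where
  "property_Delta N \<longleftrightarrow> (\<forall>x\<in>unit_sphere N. finite {f. f extreme_point_of duality_set N x})"

definition finite_dim_subspace :: "'a::real_vector set \<Rightarrow> bool" where
  "finite_dim_subspace V \<longleftrightarrow> (\<exists>B. finite B \<and> V = span B)"

text \<open>The library predicate \<^const>\<open>polytope\<close> (convex hull of a finite, possibly empty, set) serves
  as the notion of a finite-dimensional polytope.\<close>

definition K_polyhedral :: "('a::real_normed_vector \<Rightarrow> real) \<Rightarrow> bool" where
  "K_polyhedral N \<longleftrightarrow> (\<forall>V. finite_dim_subspace V \<longrightarrow> polytope (unit_ball N \<inter> V))"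

definition VI_polyhedral :: "('a::real_normed_vector \<Rightarrow> real) \<Rightarrow> bool" where
  "VI_polyhedral N \<longleftrightarrow>
     (\<forall>x\<in>unit_sphere N. \<exists>V. open V \<and> x \<in> V \<and>
        (\<forall>y\<in>V \<inter> unit_sphere N. closed_segment x y \<subseteq> unit_sphere N))"

definition LFC :: "('a::real_normed_vector \<Rightarrow> real) \<Rightarrow> bool" where
  "LFC N \<longleftrightarrow>
     (\<forall>x\<in>unit_sphere N. \<exists>U (F :: ('a \<Rightarrow>\<^sub>L real) set). open U \<and> x \<in> U \<and> finite F \<and>
        (\<forall>y\<in>U. \<forall>z\<in>U. (\<forall>f\<in>F. blinfun_apply f y = blinfun_apply f z) \<longrightarrow> N y = N z))"

text \<open>The minimal boundary is the set of weak-star exposed points of the dual unit ball.\<close>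

definition minimal_boundary :: "('a::real_normed_vector \<Rightarrow> real) \<Rightarrow> ('a \<Rightarrow>\<^sub>L real) set" where
  "minimal_boundary N =
     {f. dual_norm N f \<le> 1 \<and>
         (\<exists>x. \<forall>g. dual_norm N g \<le> 1 \<and> g \<noteq> f \<longrightarrow> blinfun_apply g x < blinfun_apply f x)}"

definition convex_body :: "'a::real_normed_vector set \<Rightarrow> bool" where
  "convex_body C \<longleftrightarrow> closed C \<and> convex C \<and> interior C \<noteq> {}"

definition tiling :: "'a::real_normed_vector set set \<Rightarrow> bool" where
  "tiling T \<longleftrightarrow>
     (\<forall>C\<in>T. convex_body C) \<and> \<Union>T = UNIV \<and>
     pairwise (\<lambda>C D. interior C \<inter> interior D = {}) T"

definition locally_finite_tiling :: "'a::real_normed_vector set set \<Rightarrow> bool" where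
  "locally_finite_tiling T \<longleftrightarrow> tiling T \<and> locally_finite_in euclidean T"

definition normed_polytope :: "'a::real_normed_vector set \<Rightarrow> bool" where
  "normed_polytope C \<longleftrightarrow>
     closed C \<and> bounded C \<and> convex C \<and>
     (\<forall>V. finite_dim_subspace V \<longrightarrow> polytope (C \<inter> V))"

definition symmetric_polytope_tiling :: "'a::real_normed_vector set set \<Rightarrow> bool" where
  "symmetric_polytope_tiling T \<longleftrightarrow>
     locally_finite_tiling T \<and> (\<forall>C\<in>T. normed_polytope C) \<and> (\<exists>C\<in>T. uminus ` C = C)"

end

theory Submission
  imports Defs
begin

text \<open>
  All conditions on a norm, and the existence of a tiling, amount to one local property,
  \<open>locally_finite_max\<close>: near each nonzero point, \<open>N\<close> is the maximum of
  finitely many functionals of the dual unit ball.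

  For a (VI)-polyhedral norm with property \<open>\<Delta>\<close>, near a point \<open>x\<close> of
  the sphere these are the finitely many extreme points of the duality set of \<open>x\<close>. If
  the norm is (K)-polyhedral and LFC, it agrees near \<open>x\<close> with a polyhedral seminorm
  that factors through a finite-rank projection, and the extreme minorants of that seminorm are
  finite in number. If a locally finite tiling by bounded convex bodies is given, a single tile is
  locally the intersection of the half-spaces that separate it from its neighbours, so its gauge is
  a local maximum of finitely many functionals, and the gauge is then made symmetric. The
  functionals in all three arguments come from \<open>extreme_minorant_attaining\<close>: every
  sublinear functional has, for each point, an extreme linear minorant that attains it there. It is
  obtained by applying Zorn's lemma to faces, each represented by a sublinear functional.

  Conversely, the local property yields (VI) and LFC at once. Property \<open>\<Delta>\<close> holds
  because an extreme point of the set of functionals below a finite maximum is one of those in the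
  maximum (\<open>extreme_below_finite_max\<close>). For (K), compactness turns the local maxima on
  a finite-dimensional subspace into one finite maximum, and bounded solution sets of finitely many
  linear inequalities are polytopes (\<open>polytope_of_inequalities\<close>).

  For the tiling of a nonzero space, the functionals in the local maxima can be restricted to those
  whose contact set with \<open>N\<close> has interior points
  (\<open>locally_max_of_facet_functionals\<close>); they form the minimal boundary. The cones over
  the corresponding facets cover the space, overlap only in their boundaries, and are locally finite
  away from 0. Cutting them by spheres of radius 1, 2, 3, and so on, and replacing what is inside
  the first sphere by the unit ball, gives a locally finite tiling by polytopes. Each facet
  contributes countably many tiles, and an infinite-dimensional space has infinitely many facets, so
  the cardinality is that of the minimal boundary.
\<close>

section \<open>Sublinear functionals and their extreme linear minorants\<close>

definition sublinear :: "('a::real_vector \<Rightarrow> real) \<Rightarrow> bool" where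
  "sublinear p \<longleftrightarrow> (\<forall>x y. p (x + y) \<le> p x + p y) \<and> (\<forall>c x. 0 \<le> c \<longrightarrow> p (c *\<^sub>R x) = c * p x)"

lemma sublinear_add: "sublinear p \<Longrightarrow> p (x + y) \<le> p x + p y"
  by (simp add: sublinear_def)

lemma sublinear_scale: "sublinear p \<Longrightarrow> 0 \<le> c \<Longrightarrow> p (c *\<^sub>R x) = c * p x"
  by (simp add: sublinear_def)

lemma sublinear_0 [simp]: "sublinear p \<Longrightarrow> p 0 = 0"
  using sublinear_scale[of p 0 0] by simp

lemma sublinear_neg: "sublinear p \<Longrightarrow> - p (- x) \<le> p x"
  using sublinear_add[of p x "- x"] by simp

lemma sublinear_odd_imp_linear:
  assumes p: "sublinear p" and odd: "\<And>x. p (- x) \<le> - p x"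
  shows "linear p"
proof
  have neg: "p (- x) = - p x" for x
    using odd[of x] sublinear_neg[OF p, of x] by simp
  show "p (x + y) = p x + p y" for x y
    using sublinear_add[OF p, of x y] sublinear_add[OF p, of "- x" "- y"] neg[of x] neg[of y]
      neg[of "x + y"] by simp
  show "p (c *\<^sub>R x) = c *\<^sub>R p x" for c x
  proof (cases "0 \<le> c")
    case False
    then have "p (c *\<^sub>R x) = - p ((- c) *\<^sub>R x)" using neg[of "(- c) *\<^sub>R x"] by simp
    with False show ?thesis using sublinear_scale[OF p, of "- c" x] by simp
  qed (simp add: sublinear_scale[OF p])
qed

lemma linear_le_linear_eq:
  fixes f g :: "'a::real_vector \<Rightarrow> real"
  assumes "linear f" "linear g" "\<And>x. f x \<le> g x"
  shows "f = g"
proof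
  fix x show "f x = g x"
    using assms(3)[of x] assms(3)[of "- x"] by (simp add: linear_neg assms(1,2))
qed

text \<open>The linear functionals below \<open>face_functional p y\<close> are those linear \<open>f \<le> p\<close> that satisfy
  \<open>f y = p y\<close>: the sublinear counterpart of the face of a convex set on which \<open>y\<close> is maximal. For
  \<open>p\<close> a norm and \<open>p y = 1\<close> they form the duality set of \<open>y\<close>.\<close>

definition face_functional :: "('a::real_vector \<Rightarrow> real) \<Rightarrow> 'a \<Rightarrow> 'a \<Rightarrow> real" where
  "face_functional p y z = (INF t\<in>{0..}. p (z + t *\<^sub>R y) - t * p y)"

lemma face_functional_lower:
  assumes p: "sublinear p" and "0 \<le> t"
  shows "face_functional p y z \<le> p (z + t *\<^sub>R y) - t * p y"
proof -
  have "- p (- z) \<le> p (z + t *\<^sub>R y) - t * p y" if "0 \<le> t" for t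
    using sublinear_add[OF p, of "z + t *\<^sub>R y" "- z"] sublinear_scale[OF p that, of y] by simp
  then have "bdd_below ((\<lambda>t. p (z + t *\<^sub>R y) - t * p y) ` {0..})"
    by (auto intro!: bdd_belowI)
  then show ?thesis unfolding face_functional_def
    using assms(2) by (intro cINF_lower) auto
qed

lemma face_functional_greatest:
  assumes "\<And>t. 0 \<le> t \<Longrightarrow> a \<le> p (z + t *\<^sub>R y) - t * p y"
  shows "a \<le> face_functional p y z"
  unfolding face_functional_def by (rule cINF_greatest) (use assms in auto)

lemma face_functional_le:
  assumes "sublinear p" shows "face_functional p y z \<le> p z"
  using face_functional_lower[OF assms, of 0] by simp

lemma sublinear_face_functional:
  assumes p: "sublinear p" shows "sublinear (face_functional p y)"
  unfolding sublinear_def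
proof (intro conjI allI impI)
  let ?q = "face_functional p y"
  fix z w
  have "?q (z + w) \<le> (p (z + s *\<^sub>R y) - s * p y) + (p (w + t *\<^sub>R y) - t * p y)"
    if "0 \<le> s" "0 \<le> t" for s t
  proof -
    have "?q (z + w) \<le> p ((z + s *\<^sub>R y) + (w + t *\<^sub>R y)) - (s + t) * p y"
      using face_functional_lower[OF p, of "s + t" y "z + w"] that by (simp add: algebra_simps)
    then show ?thesis
      using sublinear_add[OF p, of "z + s *\<^sub>R y" "w + t *\<^sub>R y"] by (simp add: algebra_simps)
  qed
  then have "?q (z + w) - (p (w + t *\<^sub>R y) - t * p y) \<le> ?q z" if "0 \<le> t" for t
    using that by (intro face_functional_greatest) (simp add: algebra_simps)
  then have "?q (z + w) - ?q z \<le> ?q w"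
    by (intro face_functional_greatest) (simp add: algebra_simps)
  then show "?q (z + w) \<le> ?q z + ?q w" by simp
next
  let ?q = "face_functional p y"
  have le: "?q (c *\<^sub>R z) \<le> c * ?q z" if "0 < c" for c z
  proof -
    have "?q (c *\<^sub>R z) / c \<le> ?q z"
    proof (rule face_functional_greatest)
      fix t :: real assume "0 \<le> t"
      then have "?q (c *\<^sub>R z) \<le> p (c *\<^sub>R (z + t *\<^sub>R y)) - (c * t) * p y"
        using face_functional_lower[OF p, of "c * t" y "c *\<^sub>R z"] that
        by (simp add: algebra_simps)
      also have "\<dots> = c * (p (z + t *\<^sub>R y) - t * p y)"
        using that by (simp only: sublinear_scale[OF p]) (simp add: algebra_simps)
      finally show "?q (c *\<^sub>R z) / c \<le> p (z + t *\<^sub>R y) - t * p y"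
        using that by (simp add: field_simps)
    qed
    then show ?thesis using that by (simp add: field_simps)
  qed
  fix c :: real and z assume "0 \<le> c"
  show "?q (c *\<^sub>R z) = c * ?q z"
  proof (cases "c = 0")
    case True
    have "?q 0 = 0"
    proof (rule antisym)
      show "?q 0 \<le> 0" using face_functional_le[OF p, of y 0] p by simp
      show "0 \<le> ?q 0"
        by (rule face_functional_greatest) (simp add: sublinear_scale[OF p])
    qed
    with True show ?thesis by simp
  next
    case False
    with \<open>0 \<le> c\<close> have c: "0 < c" by simp
    have "?q z \<le> (1 / c) * ?q (c *\<^sub>R z)"
      using le[of "1 / c" "c *\<^sub>R z"] c by simp
    then have "c * ?q z \<le> ?q (c *\<^sub>R z)" using c by (simp add: field_simps)
    with le[OF c, of z] show ?thesis by simp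
  qed
qed

lemma linear_le_face_functional_iff:
  assumes p: "sublinear p" and f: "linear f"
  shows "(\<forall>z. f z \<le> face_functional p y z) \<longleftrightarrow> (\<forall>z. f z \<le> p z) \<and> f y = p y"
proof (intro iffI conjI allI)
  fix z assume le: "\<forall>z. f z \<le> face_functional p y z"
  show le_p: "f z \<le> p z" for z using le face_functional_le[OF p, of y z] order_trans by blast
  have "f (- y) \<le> - p y"
    using le[rule_format, of "- y"] face_functional_lower[OF p, of 1 y "- y"] p by simp
  then show "f y = p y" using le_p[of y] by (simp add: linear_neg[OF f])
next
  fix z assume le: "(\<forall>z. f z \<le> p z) \<and> f y = p y"
  show "f z \<le> face_functional p y z"
  proof (rule face_functional_greatest)
    fix t :: real
    have "f (z + t *\<^sub>R y) = f z + t * p y" using le by (simp add: linear_add[OF f] linear_scale[OF f])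
    then show "f z \<le> p (z + t *\<^sub>R y) - t * p y" using le by (simp add: le_diff_eq) metis
  qed
qed

text \<open>The linear functionals below \<open>q\<close> form a face of the convex set of linear functionals below
  \<open>p\<close>. Faces are handled through \<open>q\<close>, so that no topology on a space of functionals enters.\<close>

definition sublinear_face :: "('a::real_vector \<Rightarrow> real) \<Rightarrow> ('a \<Rightarrow> real) \<Rightarrow> bool" where
  "sublinear_face p q \<longleftrightarrow> sublinear q \<and> (\<forall>z. q z \<le> p z) \<and>
     (\<forall>g h u. linear g \<and> linear h \<and> (\<forall>z. g z \<le> p z) \<and> (\<forall>z. h z \<le> p z) \<and> 0 < u \<and> u < (1::real) \<and>
        (\<forall>z. (1 - u) * g z + u * h z \<le> q z) \<longrightarrow> (\<forall>z. g z \<le> q z \<and> h z \<le> q z))"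

lemma sublinear_face_face_functional:
  assumes pq: "sublinear_face p q"
  shows "sublinear_face p (face_functional q y)"
proof -
  have q: "sublinear q" using pq by (simp add: sublinear_face_def)
  show ?thesis unfolding sublinear_face_def
  proof (intro conjI)
    show "sublinear (face_functional q y)" by (rule sublinear_face_functional[OF q])
    show "\<forall>z. face_functional q y z \<le> p z"
      using pq face_functional_le[OF q] order_trans unfolding sublinear_face_def by blast
    show "\<forall>g h u. linear g \<and> linear h \<and> (\<forall>z. g z \<le> p z) \<and> (\<forall>z. h z \<le> p z) \<and> 0 < u \<and> u < (1::real) \<and>
        (\<forall>z. (1 - u) * g z + u * h z \<le> face_functional q y z) \<longrightarrow>
        (\<forall>z. g z \<le> face_functional q y z \<and> h z \<le> face_functional q y z)"
    proof (intro allI impI, elim conjE)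
      fix g h :: "'a \<Rightarrow> real" and u :: real and z
      assume g: "linear g" and h: "linear h" and le: "\<forall>z. g z \<le> p z" "\<forall>z. h z \<le> p z"
        and u: "0 < u" "u < 1" and c: "\<forall>z. (1 - u) * g z + u * h z \<le> face_functional q y z"
      define f where "f z = (1 - u) * g z + u * h z" for z
      have f: "linear f" unfolding f_def
        by (rule linearI) (simp_all add: linear_add[OF g] linear_add[OF h] linear_scale[OF g]
            linear_scale[OF h] algebra_simps)
      have fq: "\<forall>z. f z \<le> q z" "f y = q y"
        using c linear_le_face_functional_iff[OF q f, of y] by (auto simp: f_def)
      then have gh: "\<forall>z. g z \<le> q z \<and> h z \<le> q z"
        using pq g h le u unfolding sublinear_face_def f_def by blast
      have "(1 - u) * g y + u * h y = q y" using fq(2) by (simp add: f_def)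
      then have *: "(1 - u) * (q y - g y) + u * (q y - h y) = 0" by (simp add: algebra_simps)
      have "0 \<le> (1 - u) * (q y - g y)" "0 \<le> u * (q y - h y)" using gh u by simp_all
      then have "(1 - u) * (q y - g y) = 0" "u * (q y - h y) = 0" using * by linarith+
      then have "g y = q y" "h y = q y" using u by auto
      then show "g z \<le> face_functional q y z \<and> h z \<le> face_functional q y z"
        using linear_le_face_functional_iff[OF q g, of y] linear_le_face_functional_iff[OF q h, of y]
          gh by blast
    qed
  qed
qed

text \<open>The values of a chain at a point \<open>z\<close> are bounded below by \<open>- p (- z)\<close>, and two
  members can be replaced by the smaller one, which keeps the infimum subadditive. So the
  intersection of a chain of faces is again cut out by a sublinear functional, as Zorn's lemma
  requires.\<close>

lemma sublinear_face_chain_Inf: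
  fixes p :: "'a::real_vector \<Rightarrow> real"
  assumes p: "sublinear p" and face: "\<And>q. q \<in> C \<Longrightarrow> sublinear_face p q" and "C \<noteq> {}"
    and chain: "\<And>q r. q \<in> C \<Longrightarrow> r \<in> C \<Longrightarrow> (\<forall>z. q z \<le> r z) \<or> (\<forall>z. r z \<le> q z)"
  obtains u where "sublinear_face p u" "\<And>q z. q \<in> C \<Longrightarrow> u z \<le> q z"
proof
  define u where "u z = (INF q\<in>C. q z)" for z
  have "- p (- z) \<le> q z" if "q \<in> C" for q z
    using face[OF that] sublinear_neg[of q z] unfolding sublinear_face_def
    by (smt (verit))
  then have bdd: "bdd_below ((\<lambda>q. q z) ` C)" for z by (auto intro!: bdd_belowI)
  show lower: "u z \<le> q z" if "q \<in> C" for q z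
    unfolding u_def using bdd that by (rule cINF_lower)
  have greatest: "a \<le> u z" if "\<And>q. q \<in> C \<Longrightarrow> a \<le> q z" for a z
    unfolding u_def using \<open>C \<noteq> {}\<close> that by (rule cINF_greatest)
  have sub: "sublinear q" if "q \<in> C" for q using face[OF that] by (simp add: sublinear_face_def)
  have "sublinear u" unfolding sublinear_def
  proof (intro conjI allI impI)
    fix x y
    have *: "u (x + y) \<le> q x + r y" if qr: "q \<in> C" "r \<in> C" for q r
    proof -
      from chain[OF qr] obtain s where "s \<in> C" "s x \<le> q x" "s y \<le> r y"
        using qr by (metis order_refl)
      then show ?thesis
        using lower[of s "x + y"] sublinear_add[OF sub[OF \<open>s \<in> C\<close>], of x y] by linarith
    qed
    have "u (x + y) - r y \<le> u x" if "r \<in> C" for r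
      by (rule greatest) (use * that in \<open>simp add: diff_le_eq\<close>)
    then have "u (x + y) - u x \<le> u y" by (intro greatest) (simp add: diff_le_eq add.commute)
    then show "u (x + y) \<le> u x + u y" by simp
  next
    fix c :: real and x assume "0 \<le> c"
    show "u (c *\<^sub>R x) = c * u x"
    proof (rule antisym)
      show "c * u x \<le> u (c *\<^sub>R x)"
        using \<open>0 \<le> c\<close> lower by (intro greatest) (simp add: sublinear_scale[OF sub] mult_left_mono)
      show "u (c *\<^sub>R x) \<le> c * u x"
      proof (cases "c = 0")
        case True
        obtain q where "q \<in> C" using \<open>C \<noteq> {}\<close> by blast
        then show ?thesis using lower[OF \<open>q \<in> C\<close>, of 0] sub[OF \<open>q \<in> C\<close>] True by simp
      next
        case False
        with \<open>0 \<le> c\<close> have c: "0 < c" by simp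
        have "u (c *\<^sub>R x) / c \<le> u x"
          using lower[of _ "c *\<^sub>R x"] c
          by (intro greatest) (simp add: sublinear_scale[OF sub] pos_divide_le_eq mult.commute)
        then show ?thesis using c by (simp add: field_simps)
      qed
    qed
  qed
  moreover have "u z \<le> p z" for z
  proof -
    obtain q where "q \<in> C" using \<open>C \<noteq> {}\<close> by blast
    then show ?thesis using lower[of q z] face[of q] unfolding sublinear_face_def
      by (meson order_trans)
  qed
  moreover have "g z \<le> u z \<and> h z \<le> u z"
    if "linear g" "linear h" "\<forall>z. g z \<le> p z" "\<forall>z. h z \<le> p z" "0 < t" "t < 1"
      "\<forall>z. (1 - t) * g z + t * h z \<le> u z" for g h t z
  proof -
    have "g z \<le> q z \<and> h z \<le> q z" if "q \<in> C" for q
    proof -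
      have "\<forall>z. (1 - t) * g z + t * h z \<le> q z"
        using \<open>\<forall>z. (1 - t) * g z + t * h z \<le> u z\<close> lower[OF \<open>q \<in> C\<close>] order_trans by blast
      then show ?thesis using face[OF \<open>q \<in> C\<close>] that(1)
        \<open>linear g\<close> \<open>linear h\<close> \<open>\<forall>z. g z \<le> p z\<close> \<open>\<forall>z. h z \<le> p z\<close> \<open>0 < t\<close> \<open>t < 1\<close>
        unfolding sublinear_face_def by blast
    qed
    then show ?thesis by (auto intro: greatest)
  qed
  ultimately show "sublinear_face p u" unfolding sublinear_face_def by blast
qed

text \<open>A functional \<open>m\<close> that cuts out a minimal face agrees with \<open>face_functional m y\<close> for every
  \<open>y\<close>. Hence \<open>m (- y) \<le> - m y\<close>, which makes \<open>m\<close> linear: the face is a single point.\<close>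

lemma sublinear_extreme_minorant_exists:
  fixes p :: "'a::real_vector \<Rightarrow> real"
  assumes p: "sublinear p"
  obtains f where "linear f" "sublinear_face p f"
proof -
  let ?A = "{q. sublinear_face p q}" and ?P = "\<lambda>q r :: 'a \<Rightarrow> real. \<forall>z. r z \<le> q z"
  have "p \<in> ?A" using p by (simp add: sublinear_face_def)
  have "\<exists>m \<in> ?A. \<forall>a \<in> ?A. ?P m a \<longrightarrow> a = m"
  proof (rule predicate_Zorn)
    show "partial_order_on ?A (relation_of ?P ?A)"
      by (rule partial_order_on_relation_ofI) (blast intro: order_trans order_refl, blast intro: order_trans,
          blast intro: ext order_antisym)
    fix C assume C: "C \<in> Chains (relation_of ?P ?A)"
    show "\<exists>u \<in> ?A. \<forall>a \<in> C. ?P a u"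
    proof (cases "C = {}")
      case True
      then show ?thesis using \<open>p \<in> ?A\<close> by blast
    next
      case False
      have "q \<in> ?A" if "q \<in> C" for q using C that by (auto simp: Chains_def relation_of_def)
      moreover have "(\<forall>z. q z \<le> r z) \<or> (\<forall>z. r z \<le> q z)" if "q \<in> C" "r \<in> C" for q r
        using C that by (auto simp: Chains_def relation_of_def)
      ultimately obtain u where "sublinear_face p u" "\<And>q z. q \<in> C \<Longrightarrow> u z \<le> q z"
        using sublinear_face_chain_Inf[OF p _ False] by (metis mem_Collect_eq)
      then show ?thesis by blast
    qed
  qed
  then obtain m where m: "sublinear_face p m"
    and min: "\<And>a. sublinear_face p a \<Longrightarrow> \<forall>z. a z \<le> m z \<Longrightarrow> a = m" by blast
  have sm: "sublinear m" using m by (simp add: sublinear_face_def)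
  have "m (- y) \<le> - m y" for y
  proof -
    have "face_functional m y = m"
      using min[OF sublinear_face_face_functional[OF m]] face_functional_le[OF sm] by blast
    then show ?thesis using face_functional_lower[OF sm, of 1 y "- y"] sm by simp
  qed
  then have "linear m" by (rule sublinear_odd_imp_linear[OF sm])
  with m that show thesis by blast
qed

definition extreme_minorant :: "('a::real_vector \<Rightarrow> real) \<Rightarrow> ('a \<Rightarrow> real) \<Rightarrow> bool" where
  "extreme_minorant p f \<longleftrightarrow> linear f \<and> (\<forall>z. f z \<le> p z) \<and>
     (\<forall>g h u. linear g \<and> linear h \<and> (\<forall>z. g z \<le> p z) \<and> (\<forall>z. h z \<le> p z) \<and> 0 < u \<and> u < (1::real) \<and>
        (\<forall>z. f z = (1 - u) * g z + u * h z) \<longrightarrow> g = f \<and> h = f)"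

lemma extreme_minorantD:
  assumes "extreme_minorant p f" shows "linear f" "f z \<le> p z"
  using assms by (simp_all add: extreme_minorant_def)

lemma extreme_minorant_eq:
  assumes "extreme_minorant p f" "linear g" "linear h" "\<And>z. g z \<le> p z" "\<And>z. h z \<le> p z" "0 < u" "u < 1"
    "\<And>z. f z = (1 - u) * g z + u * h z"
  shows "g = f" "h = f"
  using assms unfolding extreme_minorant_def by metis+

text \<open>This plays the part of the Hahn-Banach and the Krein-Milman theorem together: among the linear
  functionals below \<open>p\<close> that are maximal at \<open>y\<close>, which form a face, there is an extreme one.\<close>

theorem extreme_minorant_attaining:
  fixes p :: "'a::real_vector \<Rightarrow> real"
  assumes p: "sublinear p"
  obtains f where "extreme_minorant p f" "f y = p y"
proof -
  let ?q = "face_functional p y"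
  have "sublinear_face p p" using p by (simp add: sublinear_face_def)
  then have pq: "sublinear_face p ?q" by (rule sublinear_face_face_functional)
  then have q: "sublinear ?q" by (simp add: sublinear_face_def)
  obtain f where f: "linear f" "sublinear_face ?q f"
    using sublinear_extreme_minorant_exists[OF q] by blast
  have fq: "\<forall>z. f z \<le> ?q z" using f(2) by (simp add: sublinear_face_def)
  have fp: "\<forall>z. f z \<le> p z" "f y = p y" using fq linear_le_face_functional_iff[OF p f(1)] by blast+
  have "g = f \<and> h = f"
    if g: "linear g" and h: "linear h" and le: "\<forall>z. g z \<le> p z" "\<forall>z. h z \<le> p z"
      and u: "0 < u" "u < 1" and eq: "\<forall>z. f z = (1 - u) * g z + u * h z" for g h u
  proof -
    have "\<forall>z. g z \<le> ?q z \<and> h z \<le> ?q z"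
      using pq g h le u fq eq unfolding sublinear_face_def by metis
    moreover have "\<forall>z. (1 - u) * g z + u * h z \<le> f z" by (simp add: eq)
    ultimately have "\<forall>z. g z \<le> f z \<and> h z \<le> f z"
      using f(2) g h u unfolding sublinear_face_def by blast
    then show ?thesis
      using linear_le_linear_eq[OF g f(1)] linear_le_linear_eq[OF h f(1)] by blast
  qed
  then have "extreme_minorant p f" using f(1) fp(1) unfolding extreme_minorant_def by blast
  then show thesis using that fp(2) by blast
qed

section \<open>Gauges and separation of convex bodies\<close>

lemma sublinear_bounded_continuous:
  fixes p :: "'a::real_normed_vector \<Rightarrow> real"
  assumes p: "sublinear p" and le: "\<And>z. p z \<le> K * norm z"
  shows "continuous_on UNIV p"
proof -
  have "\<bar>p x - p y\<bar> \<le> K * norm (x - y)" for x y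
    using sublinear_add[OF p, of "x - y" y] sublinear_add[OF p, of "y - x" x]
      le[of "x - y"] le[of "y - x"] by (simp add: norm_minus_commute)
  then have "\<bar>p x - p y\<bar> \<le> \<bar>K\<bar> * dist x y" for x y
    by (smt (verit) abs_ge_self dist_norm mult_right_mono norm_ge_zero)
  then have "\<bar>K\<bar>-lipschitz_on UNIV p"
    by (auto intro!: lipschitz_onI simp: dist_real_def)
  then show ?thesis by (rule lipschitz_on_continuous_on)
qed

lemma linear_le_bounded_linear:
  fixes f :: "'a::real_normed_vector \<Rightarrow> real"
  assumes f: "linear f" and le: "\<And>z. f z \<le> K * norm z"
  shows "bounded_linear f"
proof (rule bounded_linear_intro[where K = K])
  show "norm (f x) \<le> norm x * K" for x
    using le[of x] le[of "- x"] by (simp add: linear_neg[OF f] abs_le_iff mult.commute)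
qed (simp_all add: linear_add[OF f] linear_scale[OF f])

definition gauge_of :: "'a::real_vector set \<Rightarrow> 'a \<Rightarrow> real" where
  "gauge_of A z = Inf {t. 0 < t \<and> z /\<^sub>R t \<in> A}"

locale gauge_set =
  fixes A :: "'a::real_normed_vector set" and r :: real
  assumes convex_A: "convex A" and r_pos: "0 < r" and ball_subset: "ball 0 r \<subseteq> A"
begin

lemma zero_mem: "0 \<in> A"
  using ball_subset r_pos by auto

lemma gauge_upper: "0 < t \<Longrightarrow> z /\<^sub>R t \<in> A \<Longrightarrow> gauge_of A z \<le> t"
  unfolding gauge_of_def by (rule cInf_lower) (auto intro: bdd_belowI[of _ 0])

lemma large_mem: "norm z < r * t \<Longrightarrow> 0 < t \<and> z /\<^sub>R t \<in> A"
proof -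
  assume *: "norm z < r * t"
  then have "0 < t" using r_pos by (smt (verit) norm_ge_zero zero_less_mult_pos)
  then show "0 < t \<and> z /\<^sub>R t \<in> A"
    using * ball_subset by (auto simp: field_simps subset_iff)
qed

lemma gauge_set_nonempty: "{t. 0 < t \<and> z /\<^sub>R t \<in> A} \<noteq> {}"
proof -
  have "norm z < r * ((norm z + 1) / r)" using r_pos by simp
  then show ?thesis using large_mem by blast
qed

lemma gauge_greatest: "(\<And>t. 0 < t \<Longrightarrow> z /\<^sub>R t \<in> A \<Longrightarrow> a \<le> t) \<Longrightarrow> a \<le> gauge_of A z"
  unfolding gauge_of_def by (rule cInf_greatest[OF gauge_set_nonempty]) auto

lemma gauge_nonneg: "0 \<le> gauge_of A z"
  by (rule gauge_greatest) simp

lemma gauge_le_norm: "gauge_of A z \<le> (1 / r) * norm z"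
proof (rule field_le_epsilon)
  fix e :: real assume "0 < e"
  then have "norm z < r * ((1 / r) * norm z + e)" using r_pos by (simp add: algebra_simps)
  then show "gauge_of A z \<le> (1 / r) * norm z + e" using large_mem gauge_upper by blast
qed

lemma gauge_le_1: "z \<in> A \<Longrightarrow> gauge_of A z \<le> 1"
  using gauge_upper[of 1 z] by simp

lemma gauge_less_1_mem:
  assumes "gauge_of A z < 1" shows "z \<in> A"
proof -
  obtain t where t: "0 < t" "z /\<^sub>R t \<in> A" "t < 1"
    using cInf_lessD[OF gauge_set_nonempty assms[unfolded gauge_of_def]] by blast
  have "t *\<^sub>R (z /\<^sub>R t) + (1 - t) *\<^sub>R 0 \<in> A"
    using convexD[OF convex_A t(2) zero_mem, of t "1 - t"] t by simp
  then show ?thesis using t(1) by simp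
qed

lemma gauge_sublinear: "sublinear (gauge_of A)"
  unfolding sublinear_def
proof (intro conjI allI impI)
  fix x y
  have *: "gauge_of A (x + y) \<le> s + t" if "0 < s" "x /\<^sub>R s \<in> A" "0 < t" "y /\<^sub>R t \<in> A" for s t
  proof (rule gauge_upper)
    have "(s / (s + t)) *\<^sub>R (x /\<^sub>R s) + (t / (s + t)) *\<^sub>R (y /\<^sub>R t) \<in> A"
      using that by (intro convexD[OF convex_A]) (simp_all add: add_divide_distrib[symmetric])
    also have "(s / (s + t)) *\<^sub>R (x /\<^sub>R s) + (t / (s + t)) *\<^sub>R (y /\<^sub>R t) = (x + y) /\<^sub>R (s + t)"
    proof -
      have "(s / (s + t)) *\<^sub>R (x /\<^sub>R s) = x /\<^sub>R (s + t)" "(t / (s + t)) *\<^sub>R (y /\<^sub>R t) = y /\<^sub>R (s + t)"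
        using that by (simp_all add: divide_inverse)
      then show ?thesis by (simp only: scaleR_add_right)
    qed
    finally show "(x + y) /\<^sub>R (s + t) \<in> A" .
  qed (use that in simp)
  have "gauge_of A (x + y) - t \<le> gauge_of A x" if "0 < t" "y /\<^sub>R t \<in> A" for t
    by (rule gauge_greatest) (use * that in \<open>simp add: diff_le_eq\<close>)
  then have "gauge_of A (x + y) - gauge_of A x \<le> gauge_of A y"
    by (intro gauge_greatest) (simp add: diff_le_eq add.commute)
  then show "gauge_of A (x + y) \<le> gauge_of A x + gauge_of A y" by simp
next
  have le: "gauge_of A (c *\<^sub>R x) \<le> c * gauge_of A x" if "0 < c" for c x
  proof -
    have "gauge_of A (c *\<^sub>R x) / c \<le> gauge_of A x"
    proof (rule gauge_greatest)
      fix t assume t: "0 < t" "x /\<^sub>R t \<in> A"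
      have "gauge_of A (c *\<^sub>R x) \<le> c * t"
      proof (rule gauge_upper)
        have "inverse (c * t) * c = inverse t" using that t by (simp add: field_simps)
        then show "(c *\<^sub>R x) /\<^sub>R (c * t) \<in> A" using t by (simp only: scaleR_scaleR)
      qed (use t that in simp)
      then show "gauge_of A (c *\<^sub>R x) / c \<le> t" using that by (simp add: field_simps)
    qed
    then show ?thesis using that by (simp add: field_simps)
  qed
  fix c :: real and x assume "0 \<le> c"
  show "gauge_of A (c *\<^sub>R x) = c * gauge_of A x"
  proof (cases "c = 0")
    case True
    then show ?thesis using gauge_le_norm[of 0] gauge_nonneg[of 0] by simp
  next
    case False
    with \<open>0 \<le> c\<close> have c: "0 < c" by simp
    have "gauge_of A x \<le> (1 / c) * gauge_of A (c *\<^sub>R x)"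
      using le[of "1 / c" "c *\<^sub>R x"] c by simp
    then have "c * gauge_of A x \<le> gauge_of A (c *\<^sub>R x)" using c by (simp add: field_simps)
    with le[OF c, of x] show ?thesis by simp
  qed
qed

lemma gauge_lower_bounded:
  assumes "\<And>z. z \<in> A \<Longrightarrow> norm z \<le> R" and "0 < R"
  shows "norm z / R \<le> gauge_of A z"
proof (rule gauge_greatest)
  fix t assume "0 < t" "z /\<^sub>R t \<in> A"
  then show "norm z / R \<le> t" using assms(1)[of "z /\<^sub>R t"] assms(2) by (simp add: field_simps)
qed

lemma gauge_continuous: "continuous_on UNIV (gauge_of A)"
  using sublinear_bounded_continuous[OF gauge_sublinear gauge_le_norm] .

lemma linear_le_gauge:
  assumes f: "linear f" and "\<And>z. z \<in> A \<Longrightarrow> f z \<le> 1"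
  shows "f z \<le> gauge_of A z"
proof (rule gauge_greatest)
  fix t assume "0 < t" "z /\<^sub>R t \<in> A"
  then show "f z \<le> t" using assms(2)[of "z /\<^sub>R t"] by (simp add: linear_scale[OF f] field_simps)
qed

end

lemma mem_interior_segment:
  fixes C :: "'a::real_normed_vector set"
  assumes C: "convex C" and "c \<in> interior C" "x \<in> C" and t: "0 < t" "t \<le> 1"
  shows "x + t *\<^sub>R (c - x) \<in> interior C"
proof -
  let ?g = "\<lambda>y. (1 - t) *\<^sub>R x + t *\<^sub>R y"
  have "?g ` interior C \<subseteq> C"
    using convexD_alt[OF C \<open>x \<in> C\<close>] t interior_subset by fastforce
  moreover have "open (?g ` interior C)" using open_affinity[of "interior C" t "(1 - t) *\<^sub>R x"] t by simp
  ultimately have "?g c \<in> interior C" using assms(2) interior_maximal by blast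
  then show ?thesis by (simp add: algebra_simps)
qed

text \<open>A functional that attains, at \<open>- w\<close>, the gauge of the open convex set \<open>int C - int D - w\<close>,
  for a point \<open>w\<close> of \<open>int C - int D\<close>, separates the interiors; along segments to an interior point
  the inequalities extend to \<open>C\<close> and \<open>D\<close>.\<close>

theorem convex_bodies_separation:
  fixes C D :: "'a::real_normed_vector set"
  assumes C: "convex C" "interior C \<noteq> {}" and D: "convex D" "interior D \<noteq> {}"
    and disj: "interior C \<inter> interior D = {}"
  obtains f :: "'a \<Rightarrow>\<^sub>L real" and a :: real
  where "\<And>x. x \<in> C \<Longrightarrow> f x \<le> a" "\<And>y. y \<in> D \<Longrightarrow> a \<le> f y" "f \<noteq> 0"
proof -
  obtain c d where c: "c \<in> interior C" and d: "d \<in> interior D" using C D by blast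
  define A where "A = {(x - y) - (c - d) | x y. x \<in> interior C \<and> y \<in> interior D}"
  obtain r where r: "0 < r" "ball c r \<subseteq> interior C"
    using c open_contains_ball[of "interior C"] by auto
  have "gauge_set A r"
  proof
    show "0 < r" by (rule r)
    show "ball 0 r \<subseteq> A"
    proof
      fix z :: 'a assume "z \<in> ball 0 r"
      then have "c + z \<in> interior C" using r(2) by (auto simp: subset_iff dist_norm)
      moreover have "z = (c + z - d) - (c - d)" by simp
      ultimately show "z \<in> A" unfolding A_def using d by blast
    qed
    show "convex A"
    proof (rule convexI)
      fix p q :: 'a and u v :: real
      assume "p \<in> A" "q \<in> A" and uv: "0 \<le> u" "0 \<le> v" "u + v = 1"
      then obtain x y x' y' where *: "p = (x - y) - (c - d)" "q = (x' - y') - (c - d)"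
        "x \<in> interior C" "x' \<in> interior C" "y \<in> interior D" "y' \<in> interior D"
        unfolding A_def by blast
      have "u *\<^sub>R x + v *\<^sub>R x' \<in> interior C" "u *\<^sub>R y + v *\<^sub>R y' \<in> interior D"
        using convex_interior[OF C(1)] convex_interior[OF D(1)] * uv by (auto intro!: convexD)
      moreover have "u *\<^sub>R p + v *\<^sub>R q =
          ((u *\<^sub>R x + v *\<^sub>R x') - (u *\<^sub>R y + v *\<^sub>R y')) - (u + v) *\<^sub>R (c - d)"
        unfolding * by (simp add: algebra_simps)
      ultimately show "u *\<^sub>R p + v *\<^sub>R q \<in> A" unfolding A_def uv(3) by auto
    qed
  qed
  then interpret gauge_set A r .
  have "d - c \<notin> A" using disj unfolding A_def by auto
  then have one: "1 \<le> gauge_of A (d - c)" using gauge_less_1_mem not_le by blast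
  obtain f where f: "linear f" "\<And>z. f z \<le> gauge_of A z" "f (d - c) = gauge_of A (d - c)"
    using extreme_minorant_attaining[OF gauge_sublinear] extreme_minorantD by metis
  have bl: "bounded_linear f"
    using linear_le_bounded_linear[OF f(1), of "1 / r"] f(2) gauge_le_norm order_trans by blast
  have le: "f x \<le> f y" if "x \<in> interior C" "y \<in> interior D" for x y
  proof -
    have "f ((x - y) - (c - d)) \<le> 1"
      using f(2)[of "(x - y) - (c - d)"] gauge_le_1[of "(x - y) - (c - d)"] that
      unfolding A_def by fastforce
    then show ?thesis using one f(3) by (simp add: linear_diff[OF f(1)])
  qed
  have limit: "f z \<le> b" if "\<And>t. 0 < t \<Longrightarrow> t \<le> 1 \<Longrightarrow> f z + t * s \<le> b" for z b s
  proof -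
    have "((\<lambda>t. f z + t * s) \<longlongrightarrow> f z + 0 * s) (at_right 0)"
      by (intro tendsto_intros)
    moreover have "\<forall>\<^sub>F t in at_right 0. f z + t * s \<le> b"
      using that by (intro eventually_at_rightI[of 0 1]) auto
    ultimately have "f z + 0 * s \<le> b"
      by (rule tendsto_upperbound) simp
    then show ?thesis by simp
  qed
  have le1: "f x \<le> f y" if "x \<in> C" "y \<in> interior D" for x y
  proof (rule limit)
    fix t :: real assume "0 < t" "t \<le> 1"
    then have "x + t *\<^sub>R (c - x) \<in> interior C" using mem_interior_segment[OF C(1) c that(1)] by simp
    from le[OF this that(2)] show "f x + t * f (c - x) \<le> f y"
      by (simp add: linear_add[OF f(1)] linear_scale[OF f(1)])
  qed
  have le2: "f x \<le> f y" if "x \<in> C" "y \<in> D" for x y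
  proof -
    have "f (- y) \<le> - f x"
    proof (rule limit)
      fix t :: real assume "0 < t" "t \<le> 1"
      then have "y + t *\<^sub>R (d - y) \<in> interior D" using mem_interior_segment[OF D(1) d that(2)] by simp
      from le1[OF that(1) this] show "f (- y) + t * f (y - d) \<le> - f x"
        by (simp add: linear_add[OF f(1)] linear_scale[OF f(1)] linear_neg[OF f(1)]
            linear_diff[OF f(1)] algebra_simps)
    qed
    then show ?thesis by (simp add: linear_neg[OF f(1)])
  qed
  define a where "a = Sup (f ` C)"
  have "C \<noteq> {}" "d \<in> D" using c d interior_subset by blast+
  have bdd: "bdd_above (f ` C)" using le2[OF _ \<open>d \<in> D\<close>] by (auto intro!: bdd_aboveI)
  show thesis
  proof (rule that[of "Blinfun f" a])
    show "Blinfun f x \<le> a" if "x \<in> C" for x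
      unfolding a_def bounded_linear_Blinfun_apply[OF bl] using that bdd by (intro cSUP_upper)
    show "a \<le> Blinfun f y" if "y \<in> D" for y
      unfolding a_def bounded_linear_Blinfun_apply[OF bl]
      using that le2 \<open>C \<noteq> {}\<close> by (intro cSUP_least)
    show "Blinfun f \<noteq> 0"
      using one f(3) bounded_linear_Blinfun_apply[OF bl]
      by (metis not_one_le_zero zero_blinfun.rep_eq)
  qed
qed

section \<open>Norms that are locally maxima of finitely many functionals\<close>

text \<open>For an equivalent norm this is the common meaning of the conditions in the theorem. The
  functionals stay below \<open>N\<close> everywhere, that is, they lie in the dual unit ball of a norm \<open>N\<close>. The
  definition covers gauges as well, which need not be symmetric.\<close>

definition locally_finite_max :: "('a::real_normed_vector \<Rightarrow> real) \<Rightarrow> bool" where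
  "locally_finite_max N \<longleftrightarrow> (\<forall>x. x \<noteq> 0 \<longrightarrow> (\<exists>(F :: ('a \<Rightarrow>\<^sub>L real) set) U. finite F \<and> open U \<and> x \<in> U \<and>
     (\<forall>f\<in>F. \<forall>y. blinfun_apply f y \<le> N y) \<and> (\<forall>y\<in>U. \<exists>f\<in>F. blinfun_apply f y = N y)))"

lemma locally_finite_maxE:
  assumes "locally_finite_max N" "x \<noteq> 0"
  obtains F :: "('a::real_normed_vector \<Rightarrow>\<^sub>L real) set" and U
  where "finite F" "open U" "x \<in> U" "\<And>f y. f \<in> F \<Longrightarrow> blinfun_apply f y \<le> N y" "\<And>y. y \<in> U \<Longrightarrow> \<exists>f\<in>F. blinfun_apply f y = N y"
  using assms unfolding locally_finite_max_def by metis

lemma linear_blinfun: "linear (blinfun_apply f)" for f :: "'a::real_normed_vector \<Rightarrow>\<^sub>L real"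
  by (rule bounded_linear.linear) (rule blinfun.bounded_linear_right)

lemma open_contains_small_step:
  fixes x y :: "'a::real_normed_vector"
  assumes "open V" "x \<in> V"
  obtains t :: real where "0 < t" "t < 1" "x + t *\<^sub>R y \<in> V"
proof -
  have "((\<lambda>t. x + t *\<^sub>R y) \<longlongrightarrow> x + 0 *\<^sub>R y) (at_right 0)" by (intro tendsto_intros)
  then have "\<forall>\<^sub>F t in at_right 0. x + t *\<^sub>R y \<in> V"
    using assms by (intro topological_tendstoD) simp_all
  moreover have "\<forall>\<^sub>F t in at_right (0::real). t \<in> {0<..<1}" by (rule eventually_at_right_real) simp
  ultimately have ev: "\<forall>\<^sub>F t in at_right 0. t \<in> {0<..<1} \<and> x + t *\<^sub>R y \<in> V"
    by (rule eventually_conj[rotated])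
  obtain t :: real where "t \<in> {0<..<1} \<and> x + t *\<^sub>R y \<in> V"
    using eventually_happens'[OF trivial_limit_at_right_real ev] by blast
  then show thesis by (intro that[of t]) auto
qed

text \<open>From a point where \<open>f = p\<close>, a small step in the direction \<open>y\<close> adds \<open>t * f y\<close> to \<open>f\<close> and at most
  \<open>t * p y\<close> to \<open>p\<close>.\<close>

lemma local_minorant_imp_minorant:
  fixes f p :: "'a::real_normed_vector \<Rightarrow> real"
  assumes f: "linear f" and p: "sublinear p" and V: "open V" "x \<in> V"
    and le: "\<And>z. z \<in> V \<Longrightarrow> f z \<le> p z" and x: "f x = p x"
  shows "f y \<le> p y"
proof -
  obtain t where t: "0 < t" "x + t *\<^sub>R y \<in> V" using open_contains_small_step[OF V] by blast
  have "f x + t * f y \<le> p x + t * p y"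
    using le[OF t(2)] sublinear_add[OF p, of x "t *\<^sub>R y"] sublinear_scale[OF p, of t y] t(1)
    by (simp add: linear_add[OF f] linear_scale[OF f])
  then show ?thesis using x t(1) by simp
qed

text \<open>Positive homogeneity moves the local description along rays, so the sphere suffices.\<close>

lemma locally_finite_maxI:
  fixes N :: "'a::real_normed_vector \<Rightarrow> real"
  assumes N: "sublinear N" and cont: "continuous_on UNIV N" and pos: "\<And>x. x \<noteq> 0 \<Longrightarrow> 0 < N x"
    and local: "\<And>x. N x = 1 \<Longrightarrow> \<exists>(F :: ('a \<Rightarrow>\<^sub>L real) set) U. finite F \<and> open U \<and> x \<in> U \<and>
     (\<forall>f\<in>F. \<forall>y. blinfun_apply f y \<le> N y) \<and> (\<forall>y\<in>U. N y = 1 \<longrightarrow> (\<exists>f\<in>F. blinfun_apply f y = 1))"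
  shows "locally_finite_max N"
  unfolding locally_finite_max_def
proof (intro allI impI)
  fix x :: 'a assume "x \<noteq> 0"
  then have "0 < N x" by (rule pos)
  then have "N ((1 / N x) *\<^sub>R x) = 1" by (simp add: sublinear_scale[OF N])
  from local[OF this] obtain F :: "('a \<Rightarrow>\<^sub>L real) set" and U where F: "finite F" "open U"
    "(1 / N x) *\<^sub>R x \<in> U" "\<forall>f\<in>F. \<forall>y. blinfun_apply f y \<le> N y" "\<forall>y\<in>U. N y = 1 \<longrightarrow> (\<exists>f\<in>F. blinfun_apply f y = 1)" by blast
  define V where "V = (- {0}) \<inter> (\<lambda>y. (1 / N y) *\<^sub>R y) -` U"
  have "open V" unfolding V_def
  proof (rule continuous_open_preimage)
    show "continuous_on (- {0}) (\<lambda>y. (1 / N y) *\<^sub>R y)"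
      by (intro continuous_intros continuous_on_subset[OF cont]) (use pos in force)+
  qed (use F in auto)
  moreover have "\<exists>f\<in>F. blinfun_apply f y = N y" if "y \<in> V" for y
  proof -
    have "0 < N y" "(1 / N y) *\<^sub>R y \<in> U" using that pos by (auto simp: V_def)
    moreover from this have "N ((1 / N y) *\<^sub>R y) = 1" by (simp add: sublinear_scale[OF N])
    ultimately obtain f where "f \<in> F" "f ((1 / N y) *\<^sub>R y) = 1" using F(5) by blast
    then show ?thesis using \<open>0 < N y\<close> by (auto simp: blinfun.scaleR_right field_simps)
  qed
  moreover have "x \<in> V" using \<open>x \<noteq> 0\<close> F(3) by (simp add: V_def)
  ultimately show "\<exists>(F :: ('a \<Rightarrow>\<^sub>L real) set) U. finite F \<and> open U \<and> x \<in> U \<and>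
     (\<forall>f\<in>F. \<forall>y. blinfun_apply f y \<le> N y) \<and> (\<forall>y\<in>U. \<exists>f\<in>F. blinfun_apply f y = N y)" using F(1,4) by blast
qed

locale renorming =
  fixes N :: "'a::real_normed_vector \<Rightarrow> real"
  assumes equivalent: "equivalent_norm N"
begin

lemma nonneg: "0 \<le> N x" and eq_0_iff: "N x = 0 \<longleftrightarrow> x = 0" and triangle: "N (x + y) \<le> N x + N y"
  and homogeneous: "N (c *\<^sub>R x) = \<bar>c\<bar> * N x"
  using equivalent unfolding equivalent_norm_def by blast+

lemma pos: "x \<noteq> 0 \<Longrightarrow> 0 < N x"
  using nonneg[of x] eq_0_iff[of x] by linarith

lemma N_0 [simp]: "N 0 = 0"
  by (simp add: eq_0_iff)

lemma bounds:
  obtains m M where "0 < m" "0 < M" "\<And>x. m * norm x \<le> N x" "\<And>x. N x \<le> M * norm x"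
  using equivalent unfolding equivalent_norm_def by blast

lemma sublinear_N: "sublinear N"
  by (simp add: sublinear_def triangle homogeneous)

lemma continuous: "continuous_on A N"
  using bounds sublinear_bounded_continuous[OF sublinear_N] continuous_on_subset by (metis top_greatest)

lemma open_less: "open {y. N y < b}"
  by (rule open_Collect_less) (simp_all add: continuous)

lemma bounded_N_le: "bounded {x. N x \<le> b}"
proof -
  obtain m M where m: "0 < m" "\<And>x. m * norm x \<le> N x" using bounds by metis
  have "norm x \<le> b / m" if "N x \<le> b" for x
    using m(2)[of x] that m(1) by (simp add: pos_le_divide_eq mult.commute)
  then show ?thesis unfolding bounded_iff by auto
qed

lemma linear_le_bounded:
  assumes "linear f" "\<And>z. f z \<le> N z"
  shows "bounded_linear f"
proof -
  obtain m M where "\<And>x. N x \<le> M * norm x" using bounds by metis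
  then show ?thesis using linear_le_bounded_linear[OF assms(1)] assms(2) order_trans by blast
qed

lemma dual_norm_le_1_iff: "dual_norm N f \<le> 1 \<longleftrightarrow> (\<forall>y. f y \<le> N y)"
proof -
  obtain m M where m: "0 < m" "\<And>x. m * norm x \<le> N x" using bounds by metis
  have bdd: "bdd_above ((\<lambda>x. \<bar>f x\<bar>) ` unit_ball N)"
  proof (rule bdd_aboveI2)
    fix x assume "x \<in> unit_ball N"
    then have "m * norm x \<le> 1" using m(2)[of x] by (simp add: unit_ball_def)
    then have "norm x \<le> 1 / m" using m(1) by (simp add: field_simps)
    then show "\<bar>f x\<bar> \<le> norm f * (1 / m)"
      using norm_blinfun[of f x] mult_left_mono[of "norm x" "1 / m" "norm f"] by simp
  qed
  have "0 \<in> unit_ball N" by (simp add: unit_ball_def)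
  then have ne: "unit_ball N \<noteq> {}" by blast
  have "dual_norm N f \<le> 1 \<longleftrightarrow> (\<forall>x\<in>unit_ball N. \<bar>f x\<bar> \<le> 1)"
    unfolding dual_norm_def using cSUP_le_iff[OF ne bdd] by simp
  also have "\<dots> \<longleftrightarrow> (\<forall>y. f y \<le> N y)"
  proof
    assume *: "\<forall>x\<in>unit_ball N. \<bar>f x\<bar> \<le> 1"
    show "\<forall>y. f y \<le> N y"
    proof
      fix y show "f y \<le> N y"
      proof (cases "y = 0")
        case False
        then have "(1 / N y) *\<^sub>R y \<in> unit_ball N" using pos[OF False] by (simp add: unit_ball_def homogeneous)
        then have "\<bar>f ((1 / N y) *\<^sub>R y)\<bar> \<le> 1" using * by blast
        then show ?thesis using pos[OF False] by (simp add: blinfun.scaleR_right abs_le_iff field_simps)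
      qed simp
    qed
  next
    assume *: "\<forall>y. f y \<le> N y"
    have "\<bar>f x\<bar> \<le> N x" for x
      using *[rule_format, of x] *[rule_format, of "- x"] homogeneous[of "-1" x]
      by (simp add: blinfun.minus_right abs_le_iff)
    then show "\<forall>x\<in>unit_ball N. \<bar>f x\<bar> \<le> 1" by (force simp: unit_ball_def intro: order_trans)
  qed
  finally show ?thesis .
qed

text \<open>A value of 1 at a point of the unit sphere already forces the dual norm to be at least 1.\<close>

lemma duality_set_iff:
  assumes "N x = 1"
  shows "f \<in> duality_set N x \<longleftrightarrow> (\<forall>y. f y \<le> N y) \<and> f x = 1"
proof
  assume "f \<in> duality_set N x"
  then show "(\<forall>y. f y \<le> N y) \<and> f x = 1"
    using dual_norm_le_1_iff[of f] by (simp add: duality_set_def)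
next
  assume *: "(\<forall>y. f y \<le> N y) \<and> f x = 1"
  have "dual_norm N f \<le> 1" using * dual_norm_le_1_iff by blast
  moreover have "\<not> dual_norm N f < 1"
  proof
    assume less: "dual_norm N f < 1"
    have bd: "\<bar>f y\<bar> \<le> dual_norm N f" if "y \<in> unit_ball N" for y
    proof -
      have "\<bar>f y\<bar> \<le> N y" for y
        using * homogeneous[of "-1" y] by (metis abs_le_iff abs_minus_cancel abs_one blinfun.minus_right
            mult_1 scaleR_minus1_left)
      then have "bdd_above ((\<lambda>x. \<bar>f x\<bar>) ` unit_ball N)"
        by (intro bdd_aboveI2[where M = 1]) (auto simp: unit_ball_def intro: order_trans)
      then show ?thesis unfolding dual_norm_def using that by (intro cSUP_upper)
    qed
    show False using bd[of x] less * assms by (simp add: unit_ball_def)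
  qed
  ultimately show "f \<in> duality_set N x" using * by (simp add: duality_set_def)
qed

text \<open>Functionals that are strictly below \<open>N\<close> at \<open>x\<close> stay so nearby and can be dropped.\<close>

lemma locally_finite_max_active:
  assumes "locally_finite_max N" "N x = 1"
  obtains F :: "('a \<Rightarrow>\<^sub>L real) set" and U
  where "finite F" "open U" "x \<in> U" "\<And>f y. f \<in> F \<Longrightarrow> blinfun_apply f y \<le> N y" "\<And>f. f \<in> F \<Longrightarrow> blinfun_apply f x = 1"
    "\<And>y. y \<in> U \<Longrightarrow> \<exists>f\<in>F. blinfun_apply f y = N y"
proof -
  have "x \<noteq> 0" using assms(2) by auto
  from locally_finite_maxE[OF assms(1) this] obtain F :: "('a \<Rightarrow>\<^sub>L real) set" and U where F: "finite F"
    "open U" "x \<in> U" "\<And>f y. f \<in> F \<Longrightarrow> blinfun_apply f y \<le> N y" "\<And>y. y \<in> U \<Longrightarrow> \<exists>f\<in>F. blinfun_apply f y = N y" by metis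
  define U' where "U' = U \<inter> (\<Inter>f\<in>{f\<in>F. blinfun_apply f x \<noteq> 1}. {y. blinfun_apply f y < N y})"
  have "open U'" unfolding U'_def
    by (intro open_Int F(2) open_INT ballI open_Collect_less) (auto intro!: F(1) continuous_intros continuous)
  moreover have "x \<in> U'"
  proof -
    have "f x < N x" if "f \<in> F" "f x \<noteq> 1" for f using F(4)[OF that(1), of x] that(2) assms(2) by simp
    then show ?thesis using F(3) by (auto simp: U'_def)
  qed
  moreover have "\<exists>f\<in>{f\<in>F. blinfun_apply f x = 1}. blinfun_apply f y = N y" if "y \<in> U'" for y
    using F(5)[of y] that by (fastforce simp: U'_def)
  ultimately show thesis using F by (intro that[of "{f\<in>F. blinfun_apply f x = 1}" U']) auto
qed

end

subsection \<open>(VI)-polyhedrality and finitely many extreme supporting functionals\<close>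

text \<open>Since the segment from \<open>x\<close> to a nearby point \<open>y\<close> of the sphere stays in the sphere, a functional
  in the dual ball that is 1 at its midpoint is 1 at both ends. So some member of the duality set of
  \<open>x\<close> is 1 at \<open>y\<close>, and then so is one of the finitely many extreme points of that set.\<close>

lemma (in renorming) VI_Delta_imp_locally_finite_max:
  assumes VI: "VI_polyhedral N" and Delta: "property_Delta N"
  shows "locally_finite_max N"
proof (rule locally_finite_maxI[OF sublinear_N continuous pos])
  fix x assume x: "N x = 1"
  let ?E = "{f. f extreme_point_of duality_set N x}"
  have "finite ?E" using Delta x by (simp add: property_Delta_def unit_sphere_def)
  obtain V where V: "open V" "x \<in> V"
    "\<forall>y\<in>V \<inter> unit_sphere N. closed_segment x y \<subseteq> unit_sphere N"
    using bspec[OF VI[unfolded VI_polyhedral_def], of x] x by (auto simp: unit_sphere_def[of N])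
  let ?p = "face_functional N x"
  have p: "sublinear ?p" by (rule sublinear_face_functional[OF sublinear_N])
  have "\<exists>f\<in>?E. blinfun_apply f y = 1" if "y \<in> V" "N y = 1" for y
  proof -
    define m where "m = (1 / 2) *\<^sub>R x + (1 / 2) *\<^sub>R y"
    have "m \<in> closed_segment x y"
      unfolding m_def in_segment by (intro exI[of _ "1 / 2"]) simp
    then have "N m = 1" using V(3) that by (auto simp: unit_sphere_def)
    obtain h where h: "linear h" "\<And>z. h z \<le> N z" "h m = N m"
      using extreme_minorant_attaining[OF sublinear_N] extreme_minorantD by metis
    have "h x + h y = 2" using h(3) \<open>N m = 1\<close>
      by (simp add: m_def linear_add[OF h(1)] linear_scale[OF h(1)])
    then have hx: "h x = 1" and hy: "h y = 1" using h(2)[of x] h(2)[of y] x that by auto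
    obtain e where ext: "extreme_minorant ?p e" and att: "e y = ?p y"
      using extreme_minorant_attaining[OF p] by blast
    note e = extreme_minorantD[OF ext] att
    have eN: "\<And>z. e z \<le> N z" "e x = 1"
      using linear_le_face_functional_iff[OF sublinear_N e(1), of x] e(2) x by auto
    have "h y \<le> ?p y"
      using linear_le_face_functional_iff[OF sublinear_N h(1), of x] h(2) hx x by auto
    then have ey: "e y = 1" using e(3) hy eN(1)[of y] that by simp
    have bl: "bounded_linear e" using linear_le_bounded[OF e(1) eN(1)] .
    note app = bounded_linear_Blinfun_apply[OF bl]
    have "Blinfun e extreme_point_of duality_set N x"
      unfolding extreme_point_of_def
    proof (intro conjI ballI notI)
      show "Blinfun e \<in> duality_set N x" using eN by (simp add: duality_set_iff[OF x] app)
      fix a b assume a: "a \<in> duality_set N x" and b: "b \<in> duality_set N x"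
        and "Blinfun e \<in> open_segment a b"
      then obtain u where u: "0 < u" "u < 1" "a \<noteq> b" "Blinfun e = (1 - u) *\<^sub>R a + u *\<^sub>R b"
        by (auto simp: in_segment)
      have le: "c z \<le> ?p z" if "c \<in> duality_set N x" for c z
        using linear_le_face_functional_iff[OF sublinear_N linear_blinfun, of c x] that x duality_set_iff[OF x] by auto
      have ez: "e z = (1 - u) * a z + u * b z" for z
      proof -
        have "blinfun_apply (Blinfun e) z = (1 - u) * a z + u * b z"
          unfolding u(4) by (simp add: blinfun.add_left blinfun.scaleR_left)
        then show ?thesis by (simp add: app)
      qed
      have "blinfun_apply a = e" "blinfun_apply b = e"
        using extreme_minorant_eq[OF ext linear_blinfun linear_blinfun le[OF a] le[OF b] u(1,2) ez] .
      then show False using u(3) by (metis blinfun_apply_inject)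
    qed
    then show ?thesis using ey app by auto
  qed
  moreover have "\<forall>f\<in>?E. \<forall>y. blinfun_apply f y \<le> N y"
    using duality_set_iff[OF x] by (auto simp: extreme_point_of_def)
  ultimately show "\<exists>(F :: ('a \<Rightarrow>\<^sub>L real) set) U. finite F \<and> open U \<and> x \<in> U \<and>
     (\<forall>f\<in>F. \<forall>y. blinfun_apply f y \<le> N y) \<and> (\<forall>y\<in>U. N y = 1 \<longrightarrow> (\<exists>f\<in>F. blinfun_apply f y = 1))"
    using \<open>finite ?E\<close> V(1,2) by blast
qed

text \<open>One functional is 1 at \<open>x\<close> and at \<open>y\<close>, hence on the whole segment, which therefore cannot
  enter the interior of the ball.\<close>

lemma (in renorming) locally_finite_max_imp_VI:
  assumes "locally_finite_max N" shows "VI_polyhedral N"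
  unfolding VI_polyhedral_def
proof
  fix x assume "x \<in> unit_sphere N"
  then have x: "N x = 1" by (simp add: unit_sphere_def)
  obtain F :: "('a \<Rightarrow>\<^sub>L real) set" and U where F: "finite F" "open U" "x \<in> U"
    "\<And>f y. f \<in> F \<Longrightarrow> blinfun_apply f y \<le> N y" "\<And>f. f \<in> F \<Longrightarrow> blinfun_apply f x = 1" "\<And>y. y \<in> U \<Longrightarrow> \<exists>f\<in>F. blinfun_apply f y = N y"
    using locally_finite_max_active[OF assms x] by metis
  have "closed_segment x y \<subseteq> unit_sphere N" if y: "y \<in> U \<inter> unit_sphere N" for y
  proof
    fix z assume "z \<in> closed_segment x y"
    then obtain u where u: "0 \<le> u" "u \<le> 1" "z = (1 - u) *\<^sub>R x + u *\<^sub>R y" by (auto simp: in_segment)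
    obtain f where f: "f \<in> F" "f y = 1" using F(6)[of y] y by (auto simp: unit_sphere_def)
    have "f z = 1" using f F(5)[OF f(1)] by (simp add: u(3) blinfun.add_right blinfun.scaleR_right)
    moreover have "N z \<le> 1"
      using triangle[of "(1 - u) *\<^sub>R x" "u *\<^sub>R y"] u x y by (simp add: homogeneous unit_sphere_def)
    ultimately show "z \<in> unit_sphere N" using F(4)[OF f(1), of z] by (simp add: unit_sphere_def)
  qed
  with F(2,3) show "\<exists>V. open V \<and> x \<in> V \<and> (\<forall>y\<in>V \<inter> unit_sphere N. closed_segment x y \<subseteq> unit_sphere N)"
    by blast
qed

text \<open>The bounds that the points \<open>z\<close> impose on \<open>t\<close> are lower bounds where \<open>g z > p z\<close> and upper
  bounds where \<open>g z < p z\<close>. A lower and an upper bound never conflict: after scaling so that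
  \<open>g - p\<close> is 1 at one point and -1 at the other, \<open>g\<close> dominates \<open>p\<close> at the sum of the two points,
  so \<open>f \<le> g\<close> there, which is the required comparison of the two bounds.\<close>

lemma convex_combination_majorant:
  fixes f g p :: "'a::real_vector \<Rightarrow> real"
  assumes f: "linear f" and g: "linear g" and p: "sublinear p"
    and le: "\<And>z. f z \<le> max (g z) (p z)"
  obtains t where "0 \<le> t" "t \<le> 1" "\<And>z. f z \<le> t * g z + (1 - t) * p z"
proof -
  let ?L = "insert 0 {f z - p z | z. g z - p z = 1}"
  have cross: "f z - p z \<le> p w - f w" if "g z - p z = 1" "p w - g w = 1" for z w
    using le[of "z + w"] sublinear_add[OF p, of z w] that
    by (simp add: linear_add[OF f] linear_add[OF g])
  have upper: "l \<le> 1" if "l \<in> ?L" for l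
  proof -
    have "f z - p z \<le> 1" if "g z - p z = 1" for z using le[of z] that by simp
    then show ?thesis using that by auto
  qed
  define t where "t = Sup ?L"
  have bdd: "bdd_above ?L" using upper by (auto intro!: bdd_aboveI)
  have t_ge: "l \<le> t" if "l \<in> ?L" for l unfolding t_def using bdd that by (rule cSup_upper[rotated])
  have t_le: "t \<le> b" if "\<And>l. l \<in> ?L \<Longrightarrow> l \<le> b" for b
    unfolding t_def using that by (intro cSup_least) auto
  show thesis
  proof
    show "0 \<le> t" using t_ge by simp
    show "t \<le> 1" using t_le upper by blast
    fix z
    show "f z \<le> t * g z + (1 - t) * p z"
    proof (cases "g z" "p z" rule: linorder_cases)
      case equal
      then show ?thesis using le[of z] by (simp add: algebra_simps)
    next
      case greater
      define c where "c = 1 / (g z - p z)"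
      have c: "0 < c" "c * (g z - p z) = 1" using greater by (simp_all add: c_def)
      have "g (c *\<^sub>R z) - p (c *\<^sub>R z) = 1"
        using c by (simp add: linear_scale[OF g] sublinear_scale[OF p] algebra_simps)
      then have "f (c *\<^sub>R z) - p (c *\<^sub>R z) \<le> t" using t_ge by blast
      then have "c * (f z - p z) \<le> t"
        using c by (simp add: linear_scale[OF f] sublinear_scale[OF p] algebra_simps)
      then have "f z - p z \<le> t * (g z - p z)" using greater by (simp add: c_def pos_divide_le_eq)
      then show ?thesis by (simp add: algebra_simps)
    next
      case less
      define c where "c = 1 / (p z - g z)"
      have c: "0 < c" "c * (p z - g z) = 1" using less by (simp_all add: c_def)
      have eq: "p (c *\<^sub>R z) - g (c *\<^sub>R z) = 1"
        using c by (simp add: linear_scale[OF g] sublinear_scale[OF p] algebra_simps)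
      have "f (c *\<^sub>R z) \<le> p (c *\<^sub>R z)" using le[of "c *\<^sub>R z"] eq by simp
      then have "t \<le> p (c *\<^sub>R z) - f (c *\<^sub>R z)" using cross eq by (intro t_le) auto
      then have "t \<le> c * (p z - f z)"
        using c by (simp add: linear_scale[OF f] sublinear_scale[OF p] algebra_simps)
      then have "t * (p z - g z) \<le> p z - f z" using less by (simp add: c_def pos_le_divide_eq)
      then show ?thesis by (simp add: algebra_simps)
    qed
  qed
qed

text \<open>By induction on \<open>F\<close>: a functional below the maximum of \<open>g\<close> and the rest of \<open>F\<close> is a convex
  combination of \<open>g\<close> and a functional below the maximum of the rest, and at an extreme point this
  combination must be trivial.\<close>

lemma extreme_below_finite_max:
  fixes F :: "('a::real_normed_vector \<Rightarrow>\<^sub>L real) set"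
  assumes "finite F" and "e extreme_point_of {h. \<forall>z. \<exists>g\<in>F. blinfun_apply h z \<le> blinfun_apply g z}"
  shows "e \<in> F"
  using assms
proof (induction F arbitrary: e rule: finite_induct)
  case empty
  then show ?case by (simp add: extreme_point_of_def)
next
  case (insert g F)
  let ?D = "\<lambda>F. {h :: 'a \<Rightarrow>\<^sub>L real. \<forall>z. \<exists>g\<in>F. blinfun_apply h z \<le> blinfun_apply g z}"
  have eD: "e \<in> ?D (insert g F)" using insert.prems by (simp only: extreme_point_of_def)
  have eq: "a = b" if "\<And>z. blinfun_apply a z \<le> b z" for a b :: "'a \<Rightarrow>\<^sub>L real"
    using linear_le_linear_eq[OF linear_blinfun linear_blinfun, of a b] that by (metis blinfun_apply_inject)
  show ?case
  proof (cases "F = {}")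
    case True
    then show ?thesis using eD eq[of e g] by auto
  next
    case False
    define p where "p z = Max ((\<lambda>h. blinfun_apply h z) ` F)" for z
    have p_le: "a \<le> p z \<longleftrightarrow> (\<exists>h\<in>F. a \<le> blinfun_apply h z)" for a z
      unfolding p_def using insert.hyps(1) False by (subst Max_ge_iff) auto
    have p_ge: "h z \<le> p z" if "h \<in> F" for h z using p_le that by blast
    have p_att: "\<exists>h\<in>F. p z \<le> blinfun_apply h z" for z using p_le[of "p z" z] by simp
    have p: "sublinear p" unfolding sublinear_def
    proof (intro conjI allI impI)
      fix x y
      obtain h where "h \<in> F" "p (x + y) \<le> h (x + y)" using p_att by blast
      then show "p (x + y) \<le> p x + p y" using p_ge[of h x] p_ge[of h y] by (simp add: blinfun.add_right)
    next
      fix c :: real and x assume c: "0 \<le> c"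
      obtain h where h: "h \<in> F" "p (c *\<^sub>R x) \<le> h (c *\<^sub>R x)" using p_att by blast
      obtain k where k: "k \<in> F" "p x \<le> k x" using p_att by blast
      have "c * p x \<le> p (c *\<^sub>R x)"
        using p_ge[OF k(1), of "c *\<^sub>R x"] mult_left_mono[OF k(2) c] by (simp add: blinfun.scaleR_right)
      moreover have "p (c *\<^sub>R x) \<le> c * p x"
        using h(2) mult_left_mono[OF p_ge[OF h(1), of x] c] by (simp add: blinfun.scaleR_right)
      ultimately show "p (c *\<^sub>R x) = c * p x" by simp
    qed
    have "e z \<le> max (g z) (p z)" for z
      using eD p_ge[of _ z] by (force simp: le_max_iff_disj intro: order_trans)
    then obtain t where t: "0 \<le> t" "t \<le> 1" "\<And>z. e z \<le> t * g z + (1 - t) * p z"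
      using convex_combination_majorant[OF linear_blinfun linear_blinfun p, of e g] by metis
    consider "t = 0" | "t = 1" | "0 < t" "t < 1" using t(1,2) by linarith
    then show ?thesis
    proof cases
      case 1
      then have "e \<in> ?D F" using t(3) p_le by auto
      moreover have "?D F \<subseteq> ?D (insert g F)" by blast
      ultimately have "e extreme_point_of ?D F"
        using insert.prems unfolding extreme_point_of_def by (meson subsetD)
      then show ?thesis using insert.IH by blast
    next
      case 2
      then show ?thesis using t(3) eq[of e g] by auto
    next
      case 3
      define h where "h = (1 / (1 - t)) *\<^sub>R (e - t *\<^sub>R g)"
      have "h z \<le> p z" for z
      proof -
        have "e z - t * g z \<le> p z * (1 - t)" using t(3)[of z] by (simp add: algebra_simps)
        then show ?thesis
          using 3 by (simp add: h_def blinfun.scaleR_left blinfun.diff_left pos_divide_le_eq)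
      qed
      then have "h \<in> ?D (insert g F)" using p_le by blast
      moreover have "g \<in> ?D (insert g F)" by auto
      moreover have e: "e = (1 - t) *\<^sub>R h + t *\<^sub>R g" using 3 by (simp add: h_def)
      ultimately have "h = g"
        using insert.prems 3 unfolding extreme_point_of_def in_segment by blast
      then show ?thesis using e by (simp add: algebra_simps)
    qed
  qed
qed

text \<open>Comparing growth from \<open>x\<close> in each direction shows that the duality set of \<open>x\<close> consists of the
  functionals below the maximum of those in \<open>F\<close>, the finitely many that describe \<open>N\<close> near \<open>x\<close> and
  are 1 there.\<close>

lemma (in renorming) locally_finite_max_imp_Delta:
  assumes "locally_finite_max N" shows "property_Delta N"
  unfolding property_Delta_def
proof
  fix x assume "x \<in> unit_sphere N"
  then have x: "N x = 1" by (simp add: unit_sphere_def)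
  obtain F :: "('a \<Rightarrow>\<^sub>L real) set" and U where F: "finite F" "open U" "x \<in> U"
    "\<And>f y. f \<in> F \<Longrightarrow> blinfun_apply f y \<le> N y" "\<And>f. f \<in> F \<Longrightarrow> blinfun_apply f x = 1" "\<And>y. y \<in> U \<Longrightarrow> \<exists>f\<in>F. blinfun_apply f y = N y"
    using locally_finite_max_active[OF assms x] by metis
  have "duality_set N x = {h. \<forall>z. \<exists>g\<in>F. blinfun_apply h z \<le> blinfun_apply g z}"
  proof (intro set_eqI iffI)
    fix h assume h: "h \<in> duality_set N x"
    have "\<exists>g\<in>F. blinfun_apply h z \<le> blinfun_apply g z" for z
    proof -
      obtain t where t: "0 < t" "x + t *\<^sub>R z \<in> U" using open_contains_small_step[OF F(2,3)] by blast
      then obtain g where g: "g \<in> F" "g (x + t *\<^sub>R z) = N (x + t *\<^sub>R z)" using F(6) by blast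
      have "h (x + t *\<^sub>R z) \<le> g (x + t *\<^sub>R z)" using h g(2) duality_set_iff[OF x] by simp
      then have "t * h z \<le> t * g z"
        using F(5)[OF g(1)] h duality_set_iff[OF x] by (simp add: blinfun.add_right blinfun.scaleR_right)
      then show ?thesis using t(1) g(1) by auto
    qed
    then show "h \<in> {h. \<forall>z. \<exists>g\<in>F. blinfun_apply h z \<le> blinfun_apply g z}" by blast
  next
    fix h assume "h \<in> {h. \<forall>z. \<exists>g\<in>F. blinfun_apply h z \<le> blinfun_apply g z}"
    then have h: "\<exists>g\<in>F. blinfun_apply h z \<le> blinfun_apply g z" for z by blast
    have "h y \<le> N y" for y using h[of y] F(4) order_trans by blast
    moreover have "h x = 1"
      using h[of x] h[of "- x"] F(5) by (auto simp: blinfun.minus_right)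
    ultimately show "h \<in> duality_set N x" using duality_set_iff[OF x] by blast
  qed
  then have "{f. f extreme_point_of duality_set N x} \<subseteq> F"
    using extreme_below_finite_max[OF F(1)] by auto
  then show "finite {f. f extreme_point_of duality_set N x}" using F(1) finite_subset by blast
qed

lemma (in renorming) locally_finite_max_imp_LFC:
  assumes "locally_finite_max N" shows "LFC N"
  unfolding LFC_def
proof
  fix x assume "x \<in> unit_sphere N"
  then have x: "N x = 1" by (simp add: unit_sphere_def)
  then have "x \<noteq> 0" by auto
  obtain F :: "('a \<Rightarrow>\<^sub>L real) set" and U where F: "finite F" "open U" "x \<in> U"
    "\<And>f y. f \<in> F \<Longrightarrow> blinfun_apply f y \<le> N y" "\<And>y. y \<in> U \<Longrightarrow> \<exists>f\<in>F. blinfun_apply f y = N y"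
    using locally_finite_maxE[OF assms \<open>x \<noteq> 0\<close>] by metis
  have "N y \<le> N z" if "y \<in> U" "\<forall>f\<in>F. blinfun_apply f y = blinfun_apply f z" for y z
    using F(4,5) that by metis
  then have "N y = N z" if "y \<in> U" "z \<in> U" "\<forall>f\<in>F. blinfun_apply f y = blinfun_apply f z" for y z
    using that by (metis order_antisym)
  with F(1-3) show "\<exists>U (F :: ('a \<Rightarrow>\<^sub>L real) set). open U \<and> x \<in> U \<and> finite F \<and>
        (\<forall>y\<in>U. \<forall>z\<in>U. (\<forall>f\<in>F. blinfun_apply f y = blinfun_apply f z) \<longrightarrow> N y = N z)" by blast
qed

section \<open>Finite-dimensional subspaces and (K)-polyhedrality\<close>

text \<open>From a point that is not determined by its active inequalities one can move both ways along
  a line until a further inequality becomes active; hence every point is a convex combination of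
  the points so determined, of which there is at most one for each set of active inequalities.\<close>

theorem polytope_of_inequalities:
  fixes g :: "'i \<Rightarrow> 'a::real_vector \<Rightarrow> real"
  assumes V: "subspace V" and I: "finite I" and g: "\<And>i. i \<in> I \<Longrightarrow> linear (g i)"
    and no_ray: "\<And>d. d \<in> V \<Longrightarrow> d \<noteq> 0 \<Longrightarrow> \<exists>i\<in>I. 0 < g i d"
  shows "polytope {y \<in> V. \<forall>i\<in>I. g i y \<le> a i}"
proof -
  define Q where "Q = {y \<in> V. \<forall>i\<in>I. g i y \<le> a i}"
  define act where "act y = {i\<in>I. g i y = a i}" for y
  define W where "W = {y \<in> Q. \<forall>d\<in>V. (\<forall>i\<in>act y. g i d = 0) \<longrightarrow> d = 0}"
  note ga = linear_add[OF g] linear_scale[OF g] linear_diff[OF g] linear_neg[OF g]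
  have "inj_on act W"
  proof (rule inj_onI)
    fix y z assume y: "y \<in> W" and z: "z \<in> W" and eq: "act y = act z"
    have "y - z \<in> V" using y z subspace_diff[OF V] by (simp add: W_def Q_def)
    moreover have "\<forall>i\<in>act y. g i (y - z) = 0" using eq by (auto simp: act_def ga)
    ultimately have "y - z = 0" using y unfolding W_def by blast
    then show "y = z" by simp
  qed
  moreover have "finite (act ` W)"
    by (rule finite_subset[of _ "Pow I"]) (use I in \<open>auto simp: act_def\<close>)
  ultimately have "finite W" using finite_imageD by blast
  have move: "\<exists>t>0. y + t *\<^sub>R d \<in> Q \<and> act y \<subset> act (y + t *\<^sub>R d)"
    if y: "y \<in> Q" and d: "d \<in> V" "d \<noteq> 0" "\<forall>i\<in>act y. g i d = 0" for y d
  proof -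
    define J where "J = {i\<in>I. 0 < g i d}"
    \<comment> \<open>\<open>r i\<close> is the step length at which inequality \<open>i\<close> becomes active.\<close>
    define r where "r i = (a i - g i y) / g i d" for i
    define t where "t = Min (r ` J)"
    have J: "finite J" "J \<noteq> {}" using I no_ray d by (auto simp: J_def)
    have "0 < r i" if "i \<in> J" for i
    proof -
      have "g i y \<noteq> a i" using that d(3) by (auto simp: J_def act_def)
      then show ?thesis using that y by (force simp: J_def r_def Q_def)
    qed
    then have "0 < t" unfolding t_def using J by simp
    have t_le: "t \<le> r i" if "i \<in> J" for i unfolding t_def using J that by simp
    obtain k where k: "k \<in> J" "t = r k"
      using Min_in[of "r ` J"] J unfolding t_def by (auto simp: image_iff)
    have "g i (y + t *\<^sub>R d) \<le> a i" if i: "i \<in> I" for i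
    proof (cases "i \<in> J")
      case True
      then have "t * g i d \<le> a i - g i y"
        using t_le[OF True] by (simp add: r_def J_def pos_le_divide_eq)
      then show ?thesis using i by (simp add: ga)
    next
      case False
      then have "t * g i d \<le> 0" using i \<open>0 < t\<close> by (simp add: J_def mult_nonneg_nonpos)
      moreover have "g i y \<le> a i" using i y by (simp add: Q_def)
      ultimately show ?thesis using i by (simp add: ga)
    qed
    moreover have "y + t *\<^sub>R d \<in> V"
      using y d(1) by (simp add: Q_def subspace_add[OF V] subspace_scale[OF V])
    ultimately have "y + t *\<^sub>R d \<in> Q" by (simp add: Q_def)
    moreover have "act y \<subseteq> act (y + t *\<^sub>R d)" using d(3) by (auto simp: act_def ga)
    moreover have "k \<in> act (y + t *\<^sub>R d)"
      using k by (auto simp: act_def J_def r_def ga)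
    moreover have "k \<notin> act y" using k(1) d(3) by (auto simp: J_def)
    ultimately show ?thesis using \<open>0 < t\<close> by blast
  qed
  have "y \<in> convex hull W" if "y \<in> Q" for y
    using that
  proof (induction "card (I - act y)" arbitrary: y rule: less_induct)
    case less
    show ?case
    proof (cases "y \<in> W")
      case True
      then show ?thesis by (rule hull_inc)
    next
      case False
      then obtain d where d: "d \<in> V" "d \<noteq> 0" "\<forall>i\<in>act y. g i d = 0"
        using less.prems by (auto simp: W_def)
      have "\<forall>i\<in>act y. g i (- d) = 0" using d(3) by (auto simp: act_def ga)
      moreover have "- d \<in> V" using d(1) by (rule subspace_neg[OF V])
      ultimately obtain s where s: "0 < s" "y + s *\<^sub>R (- d) \<in> Q" "act y \<subset> act (y + s *\<^sub>R (- d))"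
        using move[OF less.prems, of "- d"] d(2) by auto
      obtain t where t: "0 < t" "y + t *\<^sub>R d \<in> Q" "act y \<subset> act (y + t *\<^sub>R d)"
        using move[OF less.prems d] by blast
      have "card (I - act z) < card (I - act y)" if "act y \<subset> act z" for z
        using that I by (intro psubset_card_mono) (auto simp: act_def)
      then have "y + t *\<^sub>R d \<in> convex hull W" "y + s *\<^sub>R (- d) \<in> convex hull W"
        using less.hyps s t by blast+
      then have "(s / (s + t)) *\<^sub>R (y + t *\<^sub>R d) + (t / (s + t)) *\<^sub>R (y + s *\<^sub>R (- d)) \<in> convex hull W"
        using s(1) t(1) by (intro convexD[OF convex_convex_hull]) (simp_all add: add_divide_distrib[symmetric])
      also have "(s / (s + t)) *\<^sub>R (y + t *\<^sub>R d) + (t / (s + t)) *\<^sub>R (y + s *\<^sub>R (- d)) =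
          (s / (s + t) + t / (s + t)) *\<^sub>R y"
        by (simp add: algebra_simps)
      also have "s / (s + t) + t / (s + t) = 1" using s(1) t(1) by (simp add: add_divide_distrib[symmetric])
      finally show ?thesis by simp
    qed
  qed
  moreover have "convex hull W \<subseteq> Q"
  proof (rule hull_minimal)
    show "W \<subseteq> Q" by (auto simp: W_def)
    show "convex Q"
    proof (rule convexI)
      fix x y and u v :: real assume *: "x \<in> Q" "y \<in> Q" "0 \<le> u" "0 \<le> v" "u + v = 1"
      have "g i (u *\<^sub>R x + v *\<^sub>R y) \<le> a i" if "i \<in> I" for i
        using that * convex_bound_le[of "g i x" "a i" "g i y" u v] by (simp add: Q_def ga)
      then show "u *\<^sub>R x + v *\<^sub>R y \<in> Q"
        using * by (simp add: Q_def subspace_add[OF V] subspace_scale[OF V])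
    qed
  qed
  ultimately have "Q = convex hull W" by blast
  with \<open>finite W\<close> show ?thesis unfolding polytope_def Q_def by blast
qed

lemma exists_functional_eq_1:
  fixes x :: "'a::real_normed_vector"
  assumes "x \<noteq> 0"
  obtains f :: "'a \<Rightarrow>\<^sub>L real" where "f x = 1"
proof -
  have "sublinear (norm :: 'a \<Rightarrow> real)" by (simp add: sublinear_def norm_triangle_ineq)
  then obtain h where h: "linear h" "\<And>z. h z \<le> norm z" "h x = norm x"
    using extreme_minorant_attaining[of norm x] extreme_minorantD by metis
  have "bounded_linear h" using linear_le_bounded_linear[OF h(1), of 1] h(2) by simp
  then have "blinfun_apply ((1 / norm x) *\<^sub>R Blinfun h) x = 1"
    using h(3) assms by (simp add: blinfun.scaleR_left bounded_linear_Blinfun_apply)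
  then show thesis by (rule that)
qed

definition projection_onto :: "('a::real_normed_vector \<Rightarrow> 'a) \<Rightarrow> 'a set \<Rightarrow> bool" where
  "projection_onto P V \<longleftrightarrow> bounded_linear P \<and> (\<forall>y. P y \<in> V) \<and> (\<forall>v\<in>V. P v = v)"

text \<open>The step of both inductions that construct projections: a direction \<open>e\<close> in the kernel of \<open>P\<close> is
  added to the range, with the coefficient read off by a functional that is 1 at \<open>e\<close>.\<close>

lemma projection_onto_insert:
  fixes f :: "'a::real_normed_vector \<Rightarrow>\<^sub>L real"
  assumes P: "projection_onto P (span B)" and e: "P e = 0" "f e = 1"
  shows "projection_onto (\<lambda>y. P y + f (y - P y) *\<^sub>R e) (span (insert e B))"
  unfolding projection_onto_def
proof (intro conjI allI ballI)
  have bl: "bounded_linear P" and mem: "\<And>y. P y \<in> span B" and id: "\<And>v. v \<in> span B \<Longrightarrow> P v = v"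
    using P by (auto simp: projection_onto_def)
  show "bounded_linear (\<lambda>y. P y + f (y - P y) *\<^sub>R e)"
    by (intro bounded_linear_add bl bounded_linear_scaleR_const bounded_linear_sub bounded_linear_ident
        bounded_linear_compose[OF blinfun.bounded_linear_right])
  show "P y + f (y - P y) *\<^sub>R e \<in> span (insert e B)" for y
    using mem[of y] span_mono[of B "insert e B"] by (intro span_add span_scale[OF span_base]) auto
  fix v assume "v \<in> span (insert e B)"
  then obtain k where "v - k *\<^sub>R e \<in> span B" using span_breakdown_eq by blast
  moreover define w where "w = v - k *\<^sub>R e"
  ultimately have w: "P w = w" "v = w + k *\<^sub>R e" using id by simp_all
  have "P v = w"
    using w e(1) by (simp add: linear_add[OF bounded_linear.linear[OF bl]] linear_scale[OF bounded_linear.linear[OF bl]])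
  then show "P v + f (v - P v) *\<^sub>R e = v" using w e(2) by (simp add: blinfun.scaleR_right)
qed

text \<open>The last clause makes bounded subsets of the finite-dimensional subspace relatively compact;
  carrying it through the induction gives the Heine-Borel property without reference to
  coordinates.\<close>

lemma finite_dim_projection_exists:
  fixes B :: "'a::real_normed_vector set"
  assumes "finite B"
  shows "\<exists>P. projection_onto P (span B) \<and> (\<forall>r. \<exists>K. compact K \<and> P ` cball 0 r \<subseteq> K)"
  using assms
proof (induction B rule: finite_induct)
  case empty
  have "projection_onto (\<lambda>_::'a. 0::'a) (span {})" by (simp add: projection_onto_def)
  moreover have "(\<lambda>_::'a. 0::'a) ` cball 0 r \<subseteq> {0}" for r by auto
  ultimately show ?case using compact_sing by blast
next
  case (insert b B)
  then obtain P where P: "projection_onto P (span B)"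
    and cpt: "\<And>r. \<exists>K. compact K \<and> P ` cball 0 r \<subseteq> K" by blast
  have bl: "bounded_linear P" and mem: "\<And>y. P y \<in> span B" and id: "\<And>v. v \<in> span B \<Longrightarrow> P v = v"
    using P by (auto simp: projection_onto_def)
  define e where "e = b - P b"
  have Pe: "P e = 0"
    using id[OF mem[of b]] by (simp add: e_def linear_diff[OF bounded_linear.linear[OF bl]])
  have span: "span (insert b B) = span (insert e B)"
    by (rule eq_span_insert_eq) (simp add: e_def mem)
  show ?case
  proof (cases "e = 0")
    case True
    then have "span (insert b B) = span B" using span by (simp add: span_insert_0)
    then show ?thesis using P cpt by auto
  next
    case False
    then obtain f :: "'a \<Rightarrow>\<^sub>L real" where f: "f e = 1" by (rule exists_functional_eq_1)
    define P' where "P' y = P y + f (y - P y) *\<^sub>R e" for y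
    have P': "projection_onto P' (span (insert b B))"
      unfolding span P'_def by (rule projection_onto_insert[OF P Pe f])
    have bl': "bounded_linear (\<lambda>y. f (y - P y))"
      by (intro bounded_linear_sub bounded_linear_ident bl
          bounded_linear_compose[OF blinfun.bounded_linear_right])
    have "\<exists>K. compact K \<and> P' ` cball 0 r \<subseteq> K" for r
    proof -
      obtain K where K: "compact K" "P ` cball 0 r \<subseteq> K" using cpt by blast
      obtain M where M: "\<And>y. norm (f (y - P y)) \<le> norm y * M" "0 < M"
        using bounded_linear.pos_bounded[OF bl'] by auto
      have "f (y - P y) \<in> {- (r * M)..r * M}" if "y \<in> cball 0 r" for y
      proof -
        have "norm y * M \<le> r * M" using that M(2) by (simp add: mult_right_mono)
        then show ?thesis using M(1)[of y] by (auto simp: abs_le_iff)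
      qed
      then have "P' ` cball 0 r \<subseteq> (\<lambda>(k, t). k + t *\<^sub>R e) ` (K \<times> {- (r * M)..r * M})"
        using K(2) by (fastforce simp: P'_def)
      moreover have "compact ((\<lambda>(k, t). k + t *\<^sub>R e) ` (K \<times> {- (r * M)..r * M}))"
        by (intro compact_continuous_image compact_Times K compact_Icc)
          (auto simp: case_prod_unfold intro!: continuous_intros)
      ultimately show ?thesis by blast
    qed
    with P' show ?thesis by blast
  qed
qed

lemma (in renorming) compact_sphere_finite_dim:
  assumes "finite B" shows "compact (span B \<inter> unit_sphere N)"
proof -
  obtain P where P: "projection_onto P (span B)" "\<And>r. \<exists>K. compact K \<and> P ` cball 0 r \<subseteq> K"
    using finite_dim_projection_exists[OF assms] by blast
  have bl: "bounded_linear P" and span: "span B = {y. P y = y}"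
    using P by (auto simp: projection_onto_def) metis
  have "closed (span B)" unfolding span
    by (intro closed_Collect_eq continuous_intros bounded_linear.continuous_on[OF bl])
  moreover have "closed (unit_sphere N)" unfolding unit_sphere_def
    by (intro closed_Collect_eq continuous continuous_intros)
  ultimately have closed: "closed (span B \<inter> unit_sphere N)" by blast
  have "bounded (unit_sphere N)"
    by (rule bounded_subset[OF bounded_N_le[of 1]]) (auto simp: unit_sphere_def)
  then obtain r where "unit_sphere N \<subseteq> cball 0 r" 
    using bounded_subset_ballD[of "unit_sphere N" 0] ball_subset_cball[of 0] by (meson order_trans)
  moreover obtain K where K: "compact K" "P ` cball 0 r \<subseteq> K" using P(2) by blast
  ultimately have "span B \<inter> unit_sphere N \<subseteq> K" unfolding span by force
  then have "span B \<inter> unit_sphere N = (span B \<inter> unit_sphere N) \<inter> K" by blast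
  then show ?thesis using closed_Int_compact[OF closed K(1)] by simp
qed

text \<open>By compactness of the sphere of \<open>V\<close>, the local maxima combine to one valid on all of \<open>V\<close>.
  Here it matters that all functionals are below \<open>N\<close> everywhere.\<close>

lemma (in renorming) finite_max_on_finite_dim:
  assumes N: "locally_finite_max N" and V: "finite_dim_subspace V"
  obtains G :: "('a \<Rightarrow>\<^sub>L real) set" where "finite G" "\<And>f y. f \<in> G \<Longrightarrow> blinfun_apply f y \<le> N y"
    "\<And>y. y \<in> V \<Longrightarrow> \<exists>f\<in>G. blinfun_apply f y = N y"
proof -
  obtain B where B: "finite B" "V = span B" using V by (auto simp: finite_dim_subspace_def)
  let ?S = "V \<inter> unit_sphere N"
  have "\<exists>(F :: ('a \<Rightarrow>\<^sub>L real) set) U. finite F \<and> open U \<and> x \<in> U \<and>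
     (\<forall>f\<in>F. \<forall>y. blinfun_apply f y \<le> N y) \<and> (\<forall>y\<in>U. \<exists>f\<in>F. blinfun_apply f y = N y)" if "x \<in> ?S" for x
  proof -
    have "x \<noteq> 0" using that by (auto simp: unit_sphere_def)
    then show ?thesis using N unfolding locally_finite_max_def by blast
  qed
  then obtain F :: "'a \<Rightarrow> ('a \<Rightarrow>\<^sub>L real) set" and U where F: "\<And>x. x \<in> ?S \<Longrightarrow> finite (F x) \<and> open (U x) \<and>
    x \<in> U x \<and> (\<forall>f\<in>F x. \<forall>y. blinfun_apply f y \<le> N y) \<and> (\<forall>y\<in>U x. \<exists>f\<in>F x. blinfun_apply f y = N y)"
    by metis
  have "compact ?S" using compact_sphere_finite_dim[OF B(1)] by (simp add: B(2))
  moreover have "open (U x)" if "x \<in> ?S" for x using F[OF that] by blast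
  moreover have "?S \<subseteq> (\<Union>x\<in>?S. U x)" using F by blast
  ultimately obtain D where D: "D \<subseteq> ?S" "finite D" "?S \<subseteq> (\<Union>x\<in>D. U x)"
    by (rule compactE_image)
  define G where "G = insert 0 (\<Union>x\<in>D. F x)"
  show thesis
  proof
    show "finite G" using D F by (auto simp: G_def)
    show "blinfun_apply f y \<le> N y" if "f \<in> G" for f y
      using that D(1) F nonneg by (auto simp: G_def)
    fix y assume y: "y \<in> V"
    show "\<exists>f\<in>G. blinfun_apply f y = N y"
    proof (cases "y = 0")
      case False
      then have "0 < N y" by (rule pos)
      then have "(1 / N y) *\<^sub>R y \<in> ?S"
        using y by (simp add: B(2) span_scale unit_sphere_def homogeneous)
      then obtain x where "x \<in> D" "(1 / N y) *\<^sub>R y \<in> U x" using D(3) by blast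
      then obtain f where f: "f \<in> F x" "blinfun_apply f ((1 / N y) *\<^sub>R y) = N ((1 / N y) *\<^sub>R y)"
        using F D(1) by blast
      have "blinfun_apply f y = N y"
        using f(2) \<open>0 < N y\<close> by (simp add: blinfun.scaleR_right homogeneous)
      then show ?thesis using f(1) \<open>x \<in> D\<close> by (auto simp: G_def)
    qed (auto simp: G_def)
  qed
qed

lemma (in renorming) locally_finite_max_imp_K:
  assumes "locally_finite_max N" shows "K_polyhedral N"
  unfolding K_polyhedral_def
proof (intro allI impI)
  fix V :: "'a set" assume V: "finite_dim_subspace V"
  obtain G :: "('a \<Rightarrow>\<^sub>L real) set" where G: "finite G" "\<And>f y. f \<in> G \<Longrightarrow> blinfun_apply f y \<le> N y"
    "\<And>y. y \<in> V \<Longrightarrow> \<exists>f\<in>G. blinfun_apply f y = N y"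
    using finite_max_on_finite_dim[OF assms V] by metis
  have "subspace V" using V by (auto simp: finite_dim_subspace_def)
  then have "polytope {y \<in> V. \<forall>f\<in>G. blinfun_apply f y \<le> 1}"
    using G(1,3) pos by (intro polytope_of_inequalities linear_blinfun) metis+
  also have "{y \<in> V. \<forall>f\<in>G. blinfun_apply f y \<le> 1} = unit_ball N \<inter> V"
  proof (intro set_eqI iffI)
    fix y assume "y \<in> {y \<in> V. \<forall>f\<in>G. blinfun_apply f y \<le> 1}"
    then show "y \<in> unit_ball N \<inter> V" using G(3)[of y] by (auto simp: unit_ball_def)
  next
    fix y assume "y \<in> unit_ball N \<inter> V"
    then show "y \<in> {y \<in> V. \<forall>f\<in>G. blinfun_apply f y \<le> 1}"
      using G(2)[of _ y] by (auto simp: unit_ball_def intro: order_trans)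
  qed
  finally show "polytope (unit_ball N \<inter> V)" .
qed

subsection \<open>(K)-polyhedrality and local dependence on finitely many functionals\<close>

text \<open>A functional \<open>g\<close> that \<open>P\<close> does not preserve is nonzero at some \<open>e\<close> in the kernel of \<open>P\<close>, and the
  functionals preserved so far vanish at \<open>e\<close>; adding a suitable multiple of \<open>e\<close> to \<open>P y\<close> corrects the
  value of \<open>g\<close> and leaves theirs unchanged.\<close>

lemma projection_preserving_functionals:
  fixes F :: "('a::real_normed_vector \<Rightarrow>\<^sub>L real) set" and x :: 'a
  assumes "finite F" and "x \<noteq> 0"
  shows "\<exists>P B. finite B \<and> projection_onto P (span B) \<and> P x = x \<and> (\<forall>f\<in>F. \<forall>y. blinfun_apply f (P y) = blinfun_apply f y)"
  using assms(1)
proof (induction F rule: finite_induct)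
  case empty
  obtain f :: "'a \<Rightarrow>\<^sub>L real" where f: "f x = 1" using exists_functional_eq_1[OF assms(2)] .
  have "projection_onto (\<lambda>_::'a. 0::'a) (span {})" by (simp add: projection_onto_def)
  from projection_onto_insert[OF this _ f]
  have "projection_onto (\<lambda>y. f y *\<^sub>R x) (span {x})" by simp
  then show ?case using f by (intro exI[of _ "\<lambda>y. f y *\<^sub>R x"] exI[of _ "{x}"]) simp
next
  case (insert g F)
  then obtain P B where P: "finite B" "projection_onto P (span B)" "P x = x"
    "\<And>f y. f \<in> F \<Longrightarrow> blinfun_apply f (P y) = blinfun_apply f y" by blast
  show ?case
  proof (cases "\<forall>y. g (P y) = g y")
    case True
    then show ?thesis using P by blast
  next
    case False
    then obtain b where b: "g (P b) \<noteq> g b" by blast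
    define e where "e = (1 / g (b - P b)) *\<^sub>R (b - P b)"
    have bl: "bounded_linear P" "P (P b) = P b" using P(2) by (auto simp: projection_onto_def)
    have ge: "g e = 1" using b by (simp add: e_def blinfun.scaleR_right blinfun.diff_right)
    have Pe: "P e = 0"
      using bl(2) by (simp add: e_def linear_scale[OF bounded_linear.linear[OF bl(1)]]
          linear_diff[OF bounded_linear.linear[OF bl(1)]])
    have fe: "f e = 0" if "f \<in> F" for f
      using P(4)[OF that] by (simp add: e_def blinfun.scaleR_right blinfun.diff_right)
    define P' where "P' y = P y + g (y - P y) *\<^sub>R e" for y
    have "projection_onto P' (span (insert e B))"
      unfolding P'_def by (rule projection_onto_insert[OF P(2) Pe ge])
    moreover have "P' x = x" by (simp add: P'_def P(3))
    moreover have "f (P' y) = f y" if "f \<in> insert g F" for f y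
      using that ge fe P(4)
      by (auto simp: P'_def blinfun.add_right blinfun.scaleR_right blinfun.diff_right)
    ultimately show ?thesis using P(1) by (intro exI[of _ P'] exI[of _ "insert e B"]) auto
  qed
qed

text \<open>An extreme minorant is determined by the vertices of the polytope at which it equals 1: if \<open>f\<close> and
  \<open>h\<close> share these, then \<open>f\<close> can be moved a little by a multiple of \<open>f - h\<close> in both directions without
  exceeding 1 at any vertex. There are only finitely many sets of vertices.\<close>

lemma (in renorming) finite_extreme_minorants:
  assumes P: "projection_onto P V" and W: "finite W" "unit_ball N \<inter> V = convex hull W"
  shows "finite {f. extreme_minorant (\<lambda>z. N (P z)) f}"
proof -
  let ?p = "\<lambda>z. N (P z)" and ?E = "{f. extreme_minorant (\<lambda>z. N (P z)) f}"
  have bl: "linear P" and mem: "\<And>y. P y \<in> V" and id: "\<And>v. v \<in> V \<Longrightarrow> P v = v"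
    using P by (auto simp: projection_onto_def bounded_linear.linear)
  have W_sub: "w \<in> V" "N w \<le> 1" if "w \<in> W" for w
    using hull_inc[OF that, of convex] W(2) by (auto simp: unit_ball_def)
  have minorant: "f z \<le> ?p z" if f: "linear f" and fP: "\<And>z. f (P z) = f z" and le: "\<And>w. w \<in> W \<Longrightarrow> f w \<le> 1" for f z
  proof (cases "P z = 0")
    case True
    then show ?thesis using fP[of z] f by (simp add: linear_0)
  next
    case False
    then have "0 < N (P z)" by (rule pos)
    have "(1 / N (P z)) *\<^sub>R P z \<in> V"
    proof -
      have "(1 / N (P z)) *\<^sub>R P z = P ((1 / N (P z)) *\<^sub>R z)" by (simp add: linear_scale[OF bl])
      then show ?thesis using mem by metis
    qed
    then have "(1 / N (P z)) *\<^sub>R P z \<in> convex hull W"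
      using \<open>0 < N (P z)\<close> unfolding W(2)[symmetric] by (simp add: unit_ball_def homogeneous)
    moreover have "convex hull W \<subseteq> {v. f v \<le> 1}"
    proof (rule hull_minimal)
      have "{v. f v \<le> 1} = f -` {..1}" by auto
      then show "convex {v. f v \<le> 1}" using convex_linear_vimage[OF f] by simp
    qed (use le in auto)
    ultimately have "f ((1 / N (P z)) *\<^sub>R P z) \<le> 1" by blast
    then show ?thesis
      using \<open>0 < N (P z)\<close> fP[of z] by (simp add: linear_scale[OF f])
  qed
  have fP: "f (P z) = f z" if "f \<in> ?E" for f z
  proof -
    have f: "linear f" "\<And>z. f z \<le> ?p z" using that extreme_minorantD by blast+
    have "P (P z - z) = 0" using id[OF mem] by (simp add: linear_diff[OF bl])
    moreover have "P (z - P z) = 0" using id[OF mem] by (simp add: linear_diff[OF bl])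
    ultimately have "f (P z - z) \<le> 0" "f (z - P z) \<le> 0" using f(2)[of "P z - z"] f(2)[of "z - P z"] by simp_all
    then show ?thesis by (simp add: linear_diff[OF f(1)])
  qed
  have le_1: "f w \<le> 1" if "f \<in> ?E" "w \<in> W" for f w
    using extreme_minorantD(2)[of ?p f w] that W_sub[OF that(2)] id by fastforce
  have "inj_on (\<lambda>f. {w\<in>W. f w = 1}) ?E"
  proof (rule inj_onI)
    fix f h assume f: "f \<in> ?E" and h: "h \<in> ?E" and eq: "{w\<in>W. f w = 1} = {w\<in>W. h w = 1}"
    define d where "d z = f z - h z" for z
    have lf: "linear f" and lh: "linear h" using f h extreme_minorantD by blast+
    have ld: "linear d" unfolding d_def
      by (rule linearI) (simp_all add: linear_add[OF lf] linear_add[OF lh] linear_scale[OF lf]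
          linear_scale[OF lh] algebra_simps)
    \<comment> \<open>The summand 1 in the denominator covers the vertices where \<open>d\<close> vanishes.\<close>
    define \<epsilon> where "\<epsilon> = Min (insert 1 ((\<lambda>w. (1 - f w) / (1 + \<bar>d w\<bar>)) ` {w\<in>W. f w \<noteq> 1}))"
    have "0 < (1 - f w) / (1 + \<bar>d w\<bar>)" if "w \<in> W" "f w \<noteq> 1" for w
      using le_1[OF f that(1)] that(2) by (intro divide_pos_pos) auto
    then have "0 < \<epsilon>" unfolding \<epsilon>_def using W(1) by (subst Min_gr_iff) auto
    have small: "f w + s * d w \<le> 1" if "w \<in> W" "\<bar>s\<bar> = \<epsilon>" for w s
    proof (cases "f w = 1")
      case True
      then have "d w = 0" using eq that(1) by (auto simp: d_def)
      with True show ?thesis by simp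
    next
      case False
      have "\<epsilon> \<le> (1 - f w) / (1 + \<bar>d w\<bar>)" unfolding \<epsilon>_def using W(1) that(1) False by (intro Min_le) auto
      then have "\<epsilon> * (1 + \<bar>d w\<bar>) \<le> 1 - f w" by (simp add: pos_le_divide_eq)
      moreover have "s * d w \<le> \<epsilon> * \<bar>d w\<bar>" using that(2) by (metis abs_ge_self abs_mult)
      ultimately show ?thesis using \<open>0 < \<epsilon>\<close> by (simp add: algebra_simps)
    qed
    have lin: "linear (\<lambda>z. f z + s * d z)" for s
      by (rule linearI) (simp_all add: linear_add[OF lf] linear_add[OF ld] linear_scale[OF lf]
          linear_scale[OF ld] algebra_simps)
    have below: "f z + s * d z \<le> ?p z" if "\<bar>s\<bar> = \<epsilon>" for s z
      by (rule minorant[OF lin]) (use small[OF _ that] fP[OF f] fP[OF h] in \<open>simp_all add: d_def\<close>)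
    have "(\<lambda>z. f z + \<epsilon> * d z) = f"
    proof (rule extreme_minorant_eq(1))
      show "extreme_minorant ?p f" using f by blast
      show "f z + \<epsilon> * d z \<le> ?p z" "f z + (- \<epsilon>) * d z \<le> ?p z" for z
        using \<open>0 < \<epsilon>\<close> by (simp_all only: below abs_minus_cancel abs_of_pos)
      show "f z = (1 - 1 / 2) * (f z + \<epsilon> * d z) + 1 / 2 * (f z + (- \<epsilon>) * d z)" for z
        by (simp add: field_simps)
      show "linear (\<lambda>z. f z + (- \<epsilon>) * d z)" by (rule lin)
    qed (use lin in simp_all)
    then have "\<epsilon> * d z = 0" for z by (metis add_cancel_right_right)
    then show "f = h" using \<open>0 < \<epsilon>\<close> by (auto simp: d_def)
  qed
  moreover have "finite ((\<lambda>f. {w\<in>W. f w = 1}) ` ?E)"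
    by (rule finite_subset[of _ "Pow W"]) (use W(1) in auto)
  ultimately show ?thesis by (rule finite_imageD[rotated])
qed

text \<open>Let \<open>P\<close> be a finite-rank projection that fixes \<open>x\<close> and preserves the functionals on which \<open>N\<close>
  depends near \<open>x\<close>. Near \<open>x\<close> the norm agrees with the seminorm \<open>N \<circ> P\<close>, which is the maximum of its
  finitely many extreme minorants. Those that are 1 at \<open>x\<close> suffice nearby, and being below \<open>N\<close> near
  \<open>x\<close> they are below \<open>N\<close> everywhere.\<close>

lemma (in renorming) K_LFC_imp_locally_finite_max:
  assumes K: "K_polyhedral N" and "LFC N"
  shows "locally_finite_max N"
proof (rule locally_finite_maxI[OF sublinear_N continuous pos])
  fix x assume x: "N x = 1"
  then have "x \<noteq> 0" by auto
  have "x \<in> unit_sphere N" using x by (simp add: unit_sphere_def)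
  from bspec[OF \<open>LFC N\<close>[unfolded LFC_def] this]
  obtain U and F0 :: "('a \<Rightarrow>\<^sub>L real) set" where U: "open U" "x \<in> U" "finite F0"
    "\<And>y z. y \<in> U \<Longrightarrow> z \<in> U \<Longrightarrow> \<forall>f\<in>F0. blinfun_apply f y = blinfun_apply f z \<Longrightarrow> N y = N z"
    by blast
  obtain P B where P: "finite B" "projection_onto P (span B)" "P x = x"
    "\<And>f y. f \<in> F0 \<Longrightarrow> blinfun_apply f (P y) = blinfun_apply f y"
    using projection_preserving_functionals[OF U(3) \<open>x \<noteq> 0\<close>] by blast
  have bl: "bounded_linear P" and lin: "linear P" and mem: "\<And>y. P y \<in> span B"
    and id: "\<And>v. v \<in> span B \<Longrightarrow> P v = v"
    using P(2) by (auto simp: projection_onto_def bounded_linear.linear)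
  let ?p = "\<lambda>z. N (P z)"
  have p: "sublinear ?p"
    by (simp add: sublinear_def linear_add[OF lin] linear_scale[OF lin] triangle homogeneous)
  have "polytope (unit_ball N \<inter> span B)"
    using K P(1) unfolding K_polyhedral_def finite_dim_subspace_def by blast
  then obtain W where W: "finite W" "unit_ball N \<inter> span B = convex hull W"
    unfolding polytope_def by blast
  have fin: "finite {f. extreme_minorant ?p f}" by (rule finite_extreme_minorants[OF P(2) W])
  define V where "V = U \<inter> P -` U"
  have "open V" unfolding V_def
    using U(1) bounded_linear.continuous_on[OF bl continuous_on_id]
    by (intro open_Int open_vimage) auto
  have N_eq: "N y = ?p y" if "y \<in> V" for y
    using that U(4)[of y "P y"] P(4) by (simp add: V_def)
  obtain m M where M: "0 < M" "\<And>x. N x \<le> M * norm x" using bounds by metis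
  obtain k where k: "\<And>y. norm (P y) \<le> norm y * k" using bounded_linear.bounded[OF bl] by blast
  have p_le: "?p z \<le> (M * k) * norm z" for z
  proof -
    have "M * norm (P z) \<le> M * (norm z * k)" using k M(1) by simp
    then show ?thesis using M(2)[of "P z"] by (simp add: mult_ac)
  qed
  have blE: "bounded_linear f" if "extreme_minorant ?p f" for f
    using linear_le_bounded_linear[of f "M * k"] extreme_minorantD[OF that] p_le order_trans by blast
  define E where "E = {f. extreme_minorant ?p f \<and> f x = 1}"
  \<comment> \<open>On \<open>U'\<close> no extreme minorant that is below 1 at \<open>x\<close> is active.\<close>
  define U' where "U' = V \<inter> (\<Inter>f\<in>{f. extreme_minorant ?p f \<and> f x \<noteq> 1}. {y. f y < ?p y})"
  have contp: "continuous_on UNIV ?p" by (rule sublinear_bounded_continuous[OF p p_le])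
  have "open U'" unfolding U'_def
  proof (intro open_Int \<open>open V\<close> open_INT ballI open_Collect_less contp)
    show "finite {f. extreme_minorant ?p f \<and> f x \<noteq> 1}" by (rule finite_subset[OF _ fin]) blast
  qed (auto intro: bounded_linear.continuous_on[OF blE continuous_on_id])
  moreover have "x \<in> U'"
  proof -
    have "f x < ?p x" if "extreme_minorant ?p f" "f x \<noteq> 1" for f
      using extreme_minorantD(2)[OF that(1), of x] that(2) x P(3) by simp
    then show ?thesis using U(2) P(3) by (auto simp: U'_def V_def)
  qed
  moreover have "f y \<le> N y" if "f \<in> E" for f y
  proof (rule local_minorant_imp_minorant[OF _ sublinear_N \<open>open V\<close>])
    show "linear f" "f x = N x" "x \<in> V"
      using that extreme_minorantD(1) x U(2) P(3) by (auto simp: E_def V_def)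
    show "f z \<le> N z" if "z \<in> V" for z
      using \<open>f \<in> E\<close> extreme_minorantD(2)[of ?p f z] N_eq[OF that] by (simp add: E_def)
  qed
  moreover have "\<exists>f\<in>E. f y = 1" if "y \<in> U'" "N y = 1" for y
  proof -
    have "y \<in> V" using that(1) by (simp add: U'_def)
    obtain f where f: "extreme_minorant ?p f" "f y = ?p y" using extreme_minorant_attaining[OF p] by blast
    have "f x = 1" using f that(1) by (force simp: U'_def)
    then show ?thesis using f N_eq[OF \<open>y \<in> V\<close>] that(2) by (auto simp: E_def)
  qed
  moreover have "finite (Blinfun ` E)"
    by (intro finite_imageI finite_subset[OF _ fin]) (auto simp: E_def)
  moreover have "blinfun_apply (Blinfun f) = f" if "f \<in> E" for f
    using blE that by (simp add: E_def bounded_linear_Blinfun_apply)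
  ultimately show "\<exists>(F :: ('a \<Rightarrow>\<^sub>L real) set) U. finite F \<and> open U \<and> x \<in> U \<and>
     (\<forall>f\<in>F. \<forall>y. blinfun_apply f y \<le> N y) \<and> (\<forall>y\<in>U. N y = 1 \<longrightarrow> (\<exists>f\<in>F. blinfun_apply f y = 1))"
    by (intro exI[of _ "Blinfun ` E"] exI[of _ U']) auto
qed

section \<open>From a tile to a norm\<close>

lemma interior_strict_less:
  fixes f :: "'a::real_normed_vector \<Rightarrow>\<^sub>L real"
  assumes "c \<in> interior C" "f \<noteq> 0" and le: "\<And>x. x \<in> C \<Longrightarrow> f x \<le> a"
  shows "f c < a"
proof -
  obtain v where "f v \<noteq> 0" using \<open>f \<noteq> 0\<close> by (metis blinfun_eqI zero_blinfun.rep_eq)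
  then obtain w where w: "0 < f w"
    by (metis blinfun.minus_right linorder_neqE_linordered_idom neg_0_less_iff_less)
  obtain t where t: "0 < t" "c + t *\<^sub>R w \<in> interior C"
    using open_contains_small_step[OF open_interior assms(1)] by blast
  have "f c + t * f w \<le> a"
    using le[of "c + t *\<^sub>R w"] t(2) interior_subset by (auto simp: blinfun.add_right blinfun.scaleR_right)
  then show ?thesis using mult_pos_pos[OF t(1) w] by linarith
qed

text \<open>Near a given point only the finitely many neighbouring tiles can cut \<open>C\<close> off, and each is
  separated from \<open>C\<close> by a hyperplane; a point strictly inside these half-spaces lies in no other
  tile.\<close>

lemma tile_locally_halfspaces:
  fixes T :: "'a::real_normed_vector set set"
  assumes T: "locally_finite_tiling T" and C: "C \<in> T" and c: "c \<in> interior C"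
  shows "\<exists>U (H :: ('a \<Rightarrow>\<^sub>L real) set). open U \<and> x \<in> U \<and> finite H \<and>
    (\<forall>h\<in>H. \<forall>z. c + z \<in> C \<longrightarrow> blinfun_apply h z \<le> 1) \<and>
    (\<forall>y\<in>U. (\<forall>h\<in>H. blinfun_apply h y \<le> 1) \<longrightarrow> c + y \<in> C)"
proof -
  have tl: "tiling T" and "locally_finite_in euclidean T"
    using T by (auto simp: locally_finite_tiling_def)
  then obtain V where V: "open V" "c + x \<in> V" "finite {D \<in> T. D \<inter> V \<noteq> {}}"
    unfolding locally_finite_in_def by (auto simp: open_openin[symmetric])
  have body: "closed D" "convex D" "interior D \<noteq> {}" if "D \<in> T" for D
    using tl that by (auto simp: tiling_def convex_body_def)
  have "\<exists>h :: 'a \<Rightarrow>\<^sub>L real. (\<forall>z. c + z \<in> C \<longrightarrow> h z \<le> 1) \<and> (\<forall>z. c + z \<in> D \<longrightarrow> 1 \<le> h z)"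
    if D: "D \<in> T" "D \<noteq> C" for D
  proof -
    have "interior C \<inter> interior D = {}"
      using tl C D unfolding tiling_def pairwise_def by blast
    then obtain f :: "'a \<Rightarrow>\<^sub>L real" and a where f: "\<And>x. x \<in> C \<Longrightarrow> f x \<le> a"
      "\<And>y. y \<in> D \<Longrightarrow> a \<le> f y" "f \<noteq> 0"
      using convex_bodies_separation[OF body(2,3)[OF C] body(2,3)[OF D(1)]] by metis
    have pos: "0 < a - f c" using interior_strict_less[OF c f(3,1)] by simp
    have "((1 / (a - f c)) *\<^sub>R f) z \<le> 1" if "c + z \<in> C" for z
      using f(1)[OF that] pos by (simp add: blinfun.scaleR_left blinfun.add_right)
    moreover have "1 \<le> ((1 / (a - f c)) *\<^sub>R f) z" if "c + z \<in> D" for z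
      using f(2)[OF that] pos by (simp add: blinfun.scaleR_left blinfun.add_right)
    ultimately show ?thesis by blast
  qed
  then obtain h :: "'a set \<Rightarrow> ('a \<Rightarrow>\<^sub>L real)" where h:
    "\<And>D z. D \<in> T \<Longrightarrow> D \<noteq> C \<Longrightarrow> c + z \<in> C \<Longrightarrow> h D z \<le> 1"
    "\<And>D z. D \<in> T \<Longrightarrow> D \<noteq> C \<Longrightarrow> c + z \<in> D \<Longrightarrow> 1 \<le> h D z" by metis
  define \<D> where "\<D> = {D \<in> T. D \<inter> V \<noteq> {}} - {C}"
  define U where "U = (\<lambda>z. c + z) -` V"
  have "open U" unfolding U_def by (rule open_vimage[OF V(1)]) (intro continuous_intros)
  have "c + y \<in> C" if y: "y \<in> U" "\<forall>g\<in>h ` \<D>. blinfun_apply g y \<le> 1" for y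
  proof -
    have lim: "((\<lambda>t. c + (1 - t) *\<^sub>R y) \<longlongrightarrow> c + (1 - 0) *\<^sub>R y) (at_right (0::real))"
      by (intro tendsto_intros)
    then have "\<forall>\<^sub>F t in at_right (0::real). c + (1 - t) *\<^sub>R y \<in> V"
      using V(1) y(1) by (intro topological_tendstoD) (simp_all add: U_def)
    moreover have "\<forall>\<^sub>F t in at_right (0::real). t \<in> {0<..<1}" by (rule eventually_at_right_real) simp
    ultimately have "\<forall>\<^sub>F t in at_right (0::real). c + (1 - t) *\<^sub>R y \<in> C"
    proof eventually_elim
      case (elim t)
      obtain D where D: "D \<in> T" "c + (1 - t) *\<^sub>R y \<in> D" using tl unfolding tiling_def by blast
      have "D = C"
      proof (rule ccontr)
        assume "D \<noteq> C"
        then have "D \<in> \<D>" using D elim by (auto simp: \<D>_def)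
        then have "h D y \<le> 1" using y(2) by simp
        then have "(1 - t) * h D y \<le> 1 - t" using elim by simp
        moreover have "1 \<le> (1 - t) * h D y"
          using h(2)[OF D(1) \<open>D \<noteq> C\<close> D(2)] by (simp add: blinfun.scaleR_right)
        ultimately show False using elim by simp
      qed
      then show ?case using D(2) by simp
    qed
    then have "c + (1 - 0) *\<^sub>R y \<in> C"
      using Lim_in_closed_set[OF body(1)[OF C] _ _ lim] by simp
    then show ?thesis by simp
  qed
  moreover have "finite (h ` \<D>)" using V(3) by (simp add: \<D>_def)
  moreover have "x \<in> U" using V(2) by (simp add: U_def)
  moreover have "\<forall>g\<in>h ` \<D>. \<forall>z. c + z \<in> C \<longrightarrow> blinfun_apply g z \<le> 1"
    using h(1) by (simp add: \<D>_def)
  ultimately show ?thesis using \<open>open U\<close> by blast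
qed

text \<open>On the boundary one of the local half-space constraints is active, as otherwise the point
  could be pushed outwards inside the set.\<close>

lemma (in gauge_set) gauge_locally_finite_max:
  assumes bounded: "\<And>z. z \<in> A \<Longrightarrow> norm z \<le> R" "0 < R"
    and half: "\<And>x. \<exists>U (H :: ('a \<Rightarrow>\<^sub>L real) set). open U \<and> x \<in> U \<and> finite H \<and>
      (\<forall>h\<in>H. \<forall>z. z \<in> A \<longrightarrow> blinfun_apply h z \<le> 1) \<and>
      (\<forall>y\<in>U. (\<forall>h\<in>H. blinfun_apply h y \<le> 1) \<longrightarrow> y \<in> A)"
  shows "locally_finite_max (gauge_of A)"
proof (rule locally_finite_maxI[OF gauge_sublinear gauge_continuous])
  fix x :: 'a assume "x \<noteq> 0"
  then have "0 < norm x / R" using bounded(2) by simp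
  then show "0 < gauge_of A x" using gauge_lower_bounded[OF bounded, of x] by linarith
next
  fix x :: 'a
  obtain U and H :: "('a \<Rightarrow>\<^sub>L real) set" where U: "open U" "x \<in> U" "finite H"
    "\<forall>h\<in>H. \<forall>z. z \<in> A \<longrightarrow> blinfun_apply h z \<le> 1"
    and mem: "\<forall>y\<in>U. (\<forall>h\<in>H. blinfun_apply h y \<le> 1) \<longrightarrow> y \<in> A"
    using half[of x] by blast
  have le: "blinfun_apply h y \<le> gauge_of A y" if "h \<in> H" for h y
    by (rule linear_le_gauge[OF linear_blinfun]) (use U(4) that in blast)
  have act: "\<exists>h\<in>H. blinfun_apply h y = 1" if y: "y \<in> U" "gauge_of A y = 1" for y
  proof (rule ccontr)
    assume "\<not> ?thesis"
    then have less: "h y < 1" if "h \<in> H" for h using le[OF that, of y] y(2) that by force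
    define O' where "O' = U \<inter> (\<Inter>h\<in>H. {z. blinfun_apply h z < 1})"
    have "open O'" unfolding O'_def
      by (intro open_Int U(1) open_INT ballI open_Collect_less U(3) continuous_intros)
    moreover have "y \<in> O'" using y(1) less by (simp add: O'_def)
    ultimately obtain t where t: "0 < t" "y + t *\<^sub>R y \<in> O'" using open_contains_small_step by blast
    then have "y + t *\<^sub>R y \<in> A" by (intro mem[rule_format]) (auto simp: O'_def less_imp_le)
    then have "gauge_of A ((1 + t) *\<^sub>R y) \<le> 1" using gauge_le_1 by (simp add: scaleR_left_distrib)
    then show False using sublinear_scale[OF gauge_sublinear, of "1 + t" y] y(2) t(1) by simp
  qed
  show "\<exists>(F :: ('a \<Rightarrow>\<^sub>L real) set) U. finite F \<and> open U \<and> x \<in> U \<and>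
     (\<forall>f\<in>F. \<forall>y. blinfun_apply f y \<le> gauge_of A y) \<and>
     (\<forall>y\<in>U. gauge_of A y = 1 \<longrightarrow> (\<exists>f\<in>F. blinfun_apply f y = 1))"
    by (intro exI[of _ H] exI[of _ U] conjI ballI allI impI U(1-3) le act)
qed

lemma locally_finite_max_symmetrize:
  fixes p :: "'a::real_normed_vector \<Rightarrow> real"
  assumes "locally_finite_max p"
  shows "locally_finite_max (\<lambda>x. max (p x) (p (- x)))"
  unfolding locally_finite_max_def
proof (intro allI impI)
  fix x :: 'a assume x: "x \<noteq> 0"
  obtain F :: "('a \<Rightarrow>\<^sub>L real) set" and U where F: "finite F" "open U" "x \<in> U"
    "\<And>f y. f \<in> F \<Longrightarrow> blinfun_apply f y \<le> p y" "\<And>y. y \<in> U \<Longrightarrow> \<exists>f\<in>F. blinfun_apply f y = p y"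
    using locally_finite_maxE[OF assms x] by metis
  have "- x \<noteq> 0" using x by simp
  then obtain G :: "('a \<Rightarrow>\<^sub>L real) set" and V where G: "finite G" "open V" "- x \<in> V"
    "\<And>f y. f \<in> G \<Longrightarrow> blinfun_apply f y \<le> p y" "\<And>y. y \<in> V \<Longrightarrow> \<exists>f\<in>G. blinfun_apply f y = p y"
    using locally_finite_maxE[OF assms] by metis
  let ?H = "F \<union> uminus ` G" and ?W = "U \<inter> uminus -` V"
  have "open ?W" by (intro open_Int F(2) open_vimage[OF G(2)] continuous_intros)
  moreover have "blinfun_apply f y \<le> max (p y) (p (- y))" if "f \<in> ?H" for f y
    using that F(4)[of f y] G(4)[of "- f" "- y"]
    by (auto simp: blinfun.minus_left blinfun.minus_right le_max_iff_disj)
  moreover have "\<exists>f\<in>?H. blinfun_apply f y = max (p y) (p (- y))" if y: "y \<in> ?W" for y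
  proof (cases "p y \<le> p (- y)")
    case True
    obtain g where "g \<in> G" "g (- y) = p (- y)" using G(5)[of "- y"] y by auto
    then have "- g \<in> ?H" "(- g) y = max (p y) (p (- y))"
      using True by (auto simp: blinfun.minus_left blinfun.minus_right max_def)
    then show ?thesis by blast
  next
    case False
    obtain f where "f \<in> F" "f y = p y" using F(5)[of y] y by auto
    then show ?thesis using False by (auto simp: max_def)
  qed
  ultimately show "\<exists>(F :: ('a \<Rightarrow>\<^sub>L real) set) U. finite F \<and> open U \<and> x \<in> U \<and>
     (\<forall>f\<in>F. \<forall>y. blinfun_apply f y \<le> max (p y) (p (- y))) \<and>
     (\<forall>y\<in>U. \<exists>f\<in>F. blinfun_apply f y = max (p y) (p (- y)))"
    using F(1,3) G(1,3) by (intro exI[of _ ?H] exI[of _ ?W]) auto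
qed

lemma (in gauge_set) equivalent_norm_symmetrized_gauge:
  assumes bounded: "\<And>z. z \<in> A \<Longrightarrow> norm z \<le> R" "0 < R"
  shows "equivalent_norm (\<lambda>x. max (gauge_of A x) (gauge_of A (- x)))"
proof -
  let ?N = "\<lambda>x. max (gauge_of A x) (gauge_of A (- x))"
  note sub = gauge_sublinear
  have low: "(1 / R) * norm x \<le> ?N x" for x using gauge_lower_bounded[OF bounded, of x] by simp
  have up: "?N x \<le> (1 / r) * norm x" for x
    using gauge_le_norm[of x] gauge_le_norm[of "- x"] by simp
  have tri: "?N (x + y) \<le> ?N x + ?N y" for x y
    using sublinear_add[OF sub, of x y] sublinear_add[OF sub, of "- x" "- y"] by (simp add: max_def)
  have hom: "?N (c *\<^sub>R x) = \<bar>c\<bar> * ?N x" for c x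
  proof -
    have pos: "?N (c *\<^sub>R x) = c * ?N x" if "0 \<le> c" for c x
      using sublinear_scale[OF sub that, of x] sublinear_scale[OF sub that, of "- x"] that
      by (simp add: max_mult_distrib_left)
    show ?thesis
    proof (cases "0 \<le> c")
      case True then show ?thesis using pos by simp
    next
      case False
      have "?N (c *\<^sub>R x) = ?N ((- c) *\<^sub>R x)" by (simp add: max.commute)
      then show ?thesis using False pos[of "- c" x] by simp
    qed
  qed
  have "?N x = 0 \<longleftrightarrow> x = 0" for x
  proof
    assume "?N x = 0"
    then have "norm x \<le> 0" using low[of x] bounded(2) by (simp add: divide_le_0_iff)
    then show "x = 0" by simp
  qed (simp add: sub)
  moreover have "0 \<le> ?N x" for x using gauge_nonneg[of x] by (simp add: le_max_iff_disj)
  moreover have "\<exists>m M. 0 < m \<and> 0 < M \<and> (\<forall>x. m * norm x \<le> ?N x \<and> ?N x \<le> M * norm x)"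
    using low up r_pos bounded(2) by (intro exI[of _ "1 / R"] exI[of _ "1 / r"]) simp
  ultimately show ?thesis unfolding equivalent_norm_def using tri hom by blast
qed

text \<open>A single tile suffices: translated so that 0 is an interior point, it has a gauge with the local
  property, and the maximum of this gauge and its reflection is the required norm.\<close>

theorem bounded_tiling_imp_norm:
  fixes T :: "'a::real_normed_vector set set"
  assumes T: "locally_finite_tiling T" and bd: "\<forall>C\<in>T. bounded C"
  obtains N :: "'a \<Rightarrow> real" where "equivalent_norm N" "locally_finite_max N"
proof -
  have "\<Union>T = UNIV" using T by (simp add: locally_finite_tiling_def tiling_def)
  then obtain C where C: "C \<in> T" by blast
  have body: "closed C" "convex C" "interior C \<noteq> {}"
    using T C by (auto simp: locally_finite_tiling_def tiling_def convex_body_def)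
  obtain c where c: "c \<in> interior C" using body(3) by blast
  define A where "A = {z. c + z \<in> C}"
  obtain r where r: "0 < r" "ball c r \<subseteq> C" using c mem_interior by blast
  have "gauge_set A r"
  proof
    show "ball 0 r \<subseteq> A" using r(2) by (auto simp: A_def subset_iff dist_norm)
    have "A = (\<lambda>x. - c + x) ` C"
    proof (intro set_eqI iffI)
      fix z assume "z \<in> A"
      then have "z = - c + (c + z)" "c + z \<in> C" by (simp_all add: A_def)
      then show "z \<in> (\<lambda>x. - c + x) ` C" by (rule image_eqI)
    qed (auto simp: A_def)
    then show "convex A" using convex_translation[OF body(2)] by simp
  qed (rule r(1))
  then interpret gauge_set A r .
  obtain R where R: "0 < R" "\<And>x. x \<in> C \<Longrightarrow> norm x \<le> R" using bd C bounded_pos by metis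
  have bdA: "norm z \<le> R + norm c" if "z \<in> A" for z
    using R(2)[of "c + z"] norm_triangle_ineq4[of "c + z" c] that by (simp add: A_def)
  have Rc: "0 < R + norm c" using R(1) by (simp add: add_pos_nonneg)
  have "locally_finite_max (gauge_of A)"
  proof (rule gauge_locally_finite_max[OF bdA Rc])
    fix x show "\<exists>U (H :: ('a \<Rightarrow>\<^sub>L real) set). open U \<and> x \<in> U \<and> finite H \<and>
      (\<forall>h\<in>H. \<forall>z. z \<in> A \<longrightarrow> blinfun_apply h z \<le> 1) \<and>
      (\<forall>y\<in>U. (\<forall>h\<in>H. blinfun_apply h y \<le> 1) \<longrightarrow> y \<in> A)"
      using tile_locally_halfspaces[OF T C c, of x] by (simp add: A_def)
  qed
  then show thesis
    using that[OF equivalent_norm_symmetrized_gauge[OF bdA Rc]] locally_finite_max_symmetrize by blast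
qed

section \<open>Facet functionals and the minimal boundary\<close>

definition facet_cone :: "('a::real_normed_vector \<Rightarrow> real) \<Rightarrow> ('a \<Rightarrow>\<^sub>L real) \<Rightarrow> 'a set" where
  "facet_cone N f = {x. f x = N x}"

text \<open>On a nonzero space this means that \<open>f\<^sup>-\<^sup>1(1)\<close> meets the unit ball in a
  facet, a set with interior points relative to this hyperplane. The cone over it is convenient
  because its interior is taken in the whole space.\<close>

definition facet_functionals :: "('a::real_normed_vector \<Rightarrow> real) \<Rightarrow> ('a \<Rightarrow>\<^sub>L real) set" where
  "facet_functionals N = {f. (\<forall>x. blinfun_apply f x \<le> N x) \<and> interior (facet_cone N f) \<noteq> {}}"

lemma facet_functional_le: "f \<in> facet_functionals N \<Longrightarrow> blinfun_apply f x \<le> N x"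
  by (simp add: facet_functionals_def)

lemma blinfun_eq_if_local_le:
  fixes f g :: "'a::real_normed_vector \<Rightarrow>\<^sub>L real"
  assumes "open V" "x \<in> V" "\<And>z. z \<in> V \<Longrightarrow> g z \<le> f z" "g x = f x"
  shows "g = f"
proof -
  have f: "sublinear (blinfun_apply f)"
    by (simp add: sublinear_def blinfun.add_right blinfun.scaleR_right)
  have "g y \<le> f y" for y
    using local_minorant_imp_minorant[OF linear_blinfun f assms(1,2,3,4)] .
  then have "blinfun_apply g = blinfun_apply f"
    by (rule linear_le_linear_eq[OF linear_blinfun linear_blinfun])
  then show ?thesis by (simp add: blinfun_apply_inject)
qed

lemma interior_Union_closed_empty:
  assumes "finite \<F>" "\<And>S. S \<in> \<F> \<Longrightarrow> closed S" "\<And>S. S \<in> \<F> \<Longrightarrow> interior S = {}"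
  shows "interior (\<Union>\<F>) = {}"
  using assms
proof (induction \<F> rule: finite_induct)
  case (insert S \<F>)
  then show ?case using interior_closed_Un_empty_interior[of S "\<Union>\<F>"] by simp
qed simp

lemma open_covered_by_finite_closed:
  assumes "open V" "V \<noteq> {}" "finite I" "\<And>i. i \<in> I \<Longrightarrow> closed (S i)" "V \<subseteq> (\<Union>i\<in>I. S i)"
  shows "\<exists>i\<in>I. interior (S i) \<noteq> {}"
proof (rule ccontr)
  assume "\<not> ?thesis"
  then have "interior (\<Union>(S ` I)) = {}"
    using assms(3,4) by (intro interior_Union_closed_empty) auto
  moreover have "V \<subseteq> interior (\<Union>(S ` I))" using assms(1,5) by (intro interior_maximal) auto
  ultimately show False using assms(2) by blast
qed

context renorming
begin

lemma closed_facet_cone: "closed (facet_cone N f)"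
  unfolding facet_cone_def by (intro closed_Collect_eq continuous continuous_intros)

lemma convex_N_le: "convex {x. N x \<le> b}"
proof (rule convexI)
  fix x y and u v :: real assume *: "x \<in> {x. N x \<le> b}" "y \<in> {x. N x \<le> b}" "0 \<le> u" "0 \<le> v" "u + v = 1"
  have "N (u *\<^sub>R x + v *\<^sub>R y) \<le> u * N x + v * N y"
    using triangle[of "u *\<^sub>R x" "v *\<^sub>R y"] *(3,4) by (simp add: homogeneous)
  also have "\<dots> \<le> b" using convex_bound_le[of "N x" b "N y" u v] * by simp
  finally show "u *\<^sub>R x + v *\<^sub>R y \<in> {x. N x \<le> b}" by simp
qed

lemma convex_facet_cone:
  assumes "\<And>x. blinfun_apply f x \<le> N x" shows "convex (facet_cone N f)"
proof (rule convexI)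
  fix x y and u v :: real
  assume *: "x \<in> facet_cone N f" "y \<in> facet_cone N f" "0 \<le> u" "0 \<le> v"
  have "N (u *\<^sub>R x + v *\<^sub>R y) \<le> u * N x + v * N y"
    using triangle[of "u *\<^sub>R x" "v *\<^sub>R y"] *(3,4) by (simp add: homogeneous)
  also have "\<dots> = f (u *\<^sub>R x + v *\<^sub>R y)"
    using *(1,2) by (simp add: facet_cone_def blinfun.add_right blinfun.scaleR_right)
  finally show "u *\<^sub>R x + v *\<^sub>R y \<in> facet_cone N f"
    using assms[of "u *\<^sub>R x + v *\<^sub>R y"] by (simp add: facet_cone_def)
qed

text \<open>A functional that touches \<open>N\<close> from below where \<open>N\<close> agrees with \<open>f\<close> on a neighbourhood touches \<open>f\<close>
  from below there, and linearity leaves no room.\<close>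

lemma facet_functionals_eq:
  assumes f: "f \<in> facet_functionals N" and V: "open V" "V \<noteq> {}" "V \<subseteq> facet_cone N f"
    and g: "\<And>x. blinfun_apply g x \<le> N x" and x: "x \<in> V" "blinfun_apply g x = N x"
  shows "g = f"
proof (rule blinfun_eq_if_local_le[OF V(1) x(1)])
  show "g z \<le> f z" if "z \<in> V" for z using V(3) that g[of z] by (auto simp: facet_cone_def)
  show "g x = f x" using V(3) x by (auto simp: facet_cone_def)
qed

text \<open>A finite union of closed sets with empty interior has empty interior, so the points where only
  functionals other than facet functionals are active cannot fill an open set: facet functionals
  suffice in the local maximum. Conversely, if the cone of a facet functional \<open>f\<close> meets \<open>U\<close>, then by
  convexity so does its interior. Any functional of the local maximum that is active at such an
  interior point equals \<open>f\<close>.\<close>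

theorem locally_max_of_facet_functionals:
  assumes N: "locally_finite_max N" and x: "x \<noteq> 0"
  obtains F U where "finite F" "F \<subseteq> facet_functionals N" "open U" "x \<in> U"
    "\<And>y. y \<in> U \<Longrightarrow> \<exists>f\<in>F. blinfun_apply f y = N y"
    "\<And>f. f \<in> facet_functionals N \<Longrightarrow> facet_cone N f \<inter> U \<noteq> {} \<Longrightarrow> f \<in> F"
proof -
  obtain F :: "('a \<Rightarrow>\<^sub>L real) set" and U where F: "finite F" "open U" "x \<in> U"
    "\<And>f y. f \<in> F \<Longrightarrow> blinfun_apply f y \<le> N y" "\<And>y. y \<in> U \<Longrightarrow> \<exists>f\<in>F. blinfun_apply f y = N y"
    using locally_finite_maxE[OF N x] by metis
  let ?F = "F \<inter> facet_functionals N"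
  have active: "\<exists>f\<in>?F. blinfun_apply f y = N y" if y: "y \<in> U" for y
  proof (rule ccontr)
    assume no: "\<not> ?thesis"
    let ?O = "U \<inter> (\<Inter>f\<in>?F. {z. blinfun_apply f z < N z})"
    have "f y < N y" if "f \<in> ?F" for f using no F(4)[of f y] that by force
    then have "y \<in> ?O" using y by auto
    moreover have "open ?O"
      using F(1) by (intro open_Int F(2) open_INT ballI open_Collect_less continuous continuous_intros) auto
    moreover have "?O \<subseteq> (\<Union>f\<in>F - facet_functionals N. facet_cone N f)"
    proof
      fix z assume z: "z \<in> ?O"
      then obtain f where f: "f \<in> F" "f z = N z" using F(5) by blast
      have "f \<notin> facet_functionals N"
      proof
        assume "f \<in> facet_functionals N"
        then have "f z < N z" using z f(1) by blast
        then show False using f(2) by simp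
      qed
      then show "z \<in> (\<Union>f\<in>F - facet_functionals N. facet_cone N f)"
        using f by (auto simp: facet_cone_def)
    qed
    ultimately obtain f where "f \<in> F - facet_functionals N" "interior (facet_cone N f) \<noteq> {}"
      using open_covered_by_finite_closed[of ?O "F - facet_functionals N" "facet_cone N"]
        F(1) closed_facet_cone by (metis (no_types, lifting) empty_iff finite_Diff)
    then show False using F(4) by (auto simp: facet_functionals_def)
  qed
  moreover have "f \<in> F" if f: "f \<in> facet_functionals N" and meets: "facet_cone N f \<inter> U \<noteq> {}" for f
  proof -
    obtain y where y: "y \<in> facet_cone N f" "y \<in> U" using meets by blast
    obtain z where z: "z \<in> interior (facet_cone N f)" using f by (auto simp: facet_functionals_def)
    have cv: "convex (facet_cone N f)" by (rule convex_facet_cone) (rule facet_functional_le[OF f])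
    obtain t where t: "0 < t" "t < 1" "y + t *\<^sub>R (z - y) \<in> U"
      using open_contains_small_step[OF F(2) y(2)] by blast
    let ?O = "U \<inter> interior (facet_cone N f)"
    have "y + t *\<^sub>R (z - y) \<in> ?O" using mem_interior_segment[OF cv z y(1), of t] t by simp
    then obtain w where w: "w \<in> ?O" by blast
    obtain g where "g \<in> F" "g w = N w" using F(5) w by blast
    have "open ?O" using F(2) by blast
    show ?thesis
      using facet_functionals_eq[OF f \<open>open ?O\<close> _ _ F(4)[OF \<open>g \<in> F\<close>] w \<open>g w = N w\<close>]
        \<open>g \<in> F\<close> w interior_subset by blast
  qed
  ultimately show thesis using F(1-3) by (intro that[of ?F U]) auto
qed

text \<open>Every interior point of the cone of a facet functional exposes it. Conversely, some facet
  functional attains \<open>N x\<close> at a point \<open>x\<close> that exposes \<open>f\<close>, and so it is \<open>f\<close>.\<close>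

lemma minimal_boundary_eq:
  assumes N: "locally_finite_max N" and nontrivial: "a \<noteq> (0 :: 'a)"
  shows "minimal_boundary N = facet_functionals N"
proof (intro set_eqI iffI)
  fix f assume "f \<in> minimal_boundary N"
  then obtain x where f: "\<And>y. blinfun_apply f y \<le> N y"
    and x: "\<And>g. (\<And>y. blinfun_apply g y \<le> N y) \<Longrightarrow> g \<noteq> f \<Longrightarrow> blinfun_apply g x < f x"
    unfolding minimal_boundary_def dual_norm_le_1_iff by blast
  \<comment> \<open>If \<open>f\<close> is exposed at 0, it is the only functional below \<open>N\<close>, and any nonzero point can serve.\<close>
  define z where "z = (if x = 0 then a else x)"
  have "z \<noteq> 0" using nontrivial by (simp add: z_def)
  obtain F U where F: "F \<subseteq> facet_functionals N" "z \<in> U"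
    "\<And>y. y \<in> U \<Longrightarrow> \<exists>f\<in>F. blinfun_apply f y = N y"
    using locally_max_of_facet_functionals[OF N \<open>z \<noteq> 0\<close>] by metis
  then obtain g where g: "g \<in> facet_functionals N" "g z = N z" by blast
  have "g x = N x" using g(2) by (cases "x = 0") (simp_all add: z_def)
  then have "\<not> g x < f x" using f[of x] by simp
  then have "g = f" using x[of g] facet_functional_le[OF g(1)] by blast
  then show "f \<in> facet_functionals N" using g(1) by simp
next
  fix f assume f: "f \<in> facet_functionals N"
  then obtain x where x: "x \<in> interior (facet_cone N f)" by (auto simp: facet_functionals_def)
  then have fx: "f x = N x" using interior_subset by (auto simp: facet_cone_def)
  have "g x < f x" if "\<And>y. blinfun_apply g y \<le> N y" "g \<noteq> f" for g
  proof (rule ccontr)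
    assume "\<not> g x < f x"
    then have "g x = N x" using that(1)[of x] fx by simp
    then have "g = f"
      using x by (intro facet_functionals_eq[OF f open_interior _ interior_subset that(1)]) auto
    then show False using that(2) by blast
  qed
  then show "f \<in> minimal_boundary N"
    unfolding minimal_boundary_def dual_norm_le_1_iff using facet_functional_le[OF f] by blast
qed

section \<open>Radial tilings\<close>

text \<open>The cone over each facet is cut by the spheres of radius 1, 2, 3, and so on; the index \<open>n\<close>
  counts from 0, and the pieces inside radius 1 merge into the unit ball, the symmetric tile.\<close>

definition facet_tile :: "('a \<Rightarrow>\<^sub>L real) \<Rightarrow> nat \<Rightarrow> 'a set" where
  "facet_tile f n = {x. f x = N x \<and> real n + 1 \<le> N x \<and> N x \<le> real n + 2}"

definition radial_tiling :: "'a set set" where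
  "radial_tiling = insert (unit_ball N) {facet_tile f n | f n. f \<in> facet_functionals N}"

lemma facet_tile_alt: "facet_tile f n = facet_cone N f \<inter> {x. real n + 1 \<le> f x} \<inter> {x. f x \<le> real n + 2}"
  by (auto simp: facet_tile_def facet_cone_def)

lemma closed_facet_tile: "closed (facet_tile f n)"
  unfolding facet_tile_alt by (intro closed_Int closed_facet_cone closed_Collect_le continuous_intros)

lemma convex_facet_tile:
  assumes "f \<in> facet_functionals N" shows "convex (facet_tile f n)"
proof -
  have "{x. real n + 1 \<le> f x} = blinfun_apply f -` {real n + 1..}" "{x. f x \<le> real n + 2} = blinfun_apply f -` {..real n + 2}"
    by auto
  then show ?thesis unfolding facet_tile_alt
    using assms by (auto intro!: convex_Int convex_facet_cone convex_linear_vimage linear_blinfun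
        simp: facet_functional_le)
qed

lemma interior_facet_tile:
  assumes f: "f \<in> facet_functionals N" and "a \<noteq> (0 :: 'a)"
  shows "interior (facet_tile f n) \<noteq> {}"
proof -
  let ?C = "interior (facet_cone N f)"
  obtain z where z: "z \<in> ?C" using f by (auto simp: facet_functionals_def)
  obtain w where w: "w \<in> ?C" "w \<noteq> 0"
  proof (cases "z = 0")
    case True
    obtain t where "0 < t" "z + t *\<^sub>R a \<in> ?C" using open_contains_small_step[OF open_interior z] by blast
    then show thesis using that True assms(2) by simp
  qed (use z that in blast)
  \<comment> \<open>Scaling by \<open>c\<close> moves \<open>w\<close> to the middle of the shell between radius \<open>n + 1\<close> and \<open>n + 2\<close>.\<close>
  define c where "c = (real n + 3 / 2) / N w"
  have "0 < c" using pos[OF w(2)] by (simp add: c_def)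
  let ?O = "(\<lambda>x. c *\<^sub>R x) ` ?C \<inter> {x. real n + 1 < N x} \<inter> {x. N x < real n + 2}"
  have "open ?O"
    using \<open>0 < c\<close> by (intro open_Int open_scaling open_interior open_Collect_less continuous continuous_intros) auto
  moreover have "?O \<subseteq> facet_tile f n"
  proof
    fix x assume x: "x \<in> ?O"
    then obtain y where "y \<in> ?C" "x = c *\<^sub>R y" by blast
    then have "f x = N x" using \<open>0 < c\<close> interior_subset[of "facet_cone N f"]
      by (auto simp: facet_cone_def blinfun.scaleR_right homogeneous)
    then show "x \<in> facet_tile f n" using x by (simp add: facet_tile_def)
  qed
  moreover have "c *\<^sub>R w \<in> ?O"
    using w pos[OF w(2)] \<open>0 < c\<close> by (auto simp: homogeneous) (simp_all add: c_def)
  ultimately show ?thesis using interior_maximal by blast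
qed

text \<open>From an interior point one can step outwards along its ray, which increases \<open>N\<close>.\<close>

lemma N_less_interior:
  assumes "y \<in> interior S" "\<And>x. x \<in> S \<Longrightarrow> N x \<le> b" "0 < b"
  shows "N y < b"
proof (cases "y = 0")
  case False
  obtain t where t: "0 < t" "y + t *\<^sub>R y \<in> interior S"
    using open_contains_small_step[OF open_interior assms(1)] by blast
  have "y + t *\<^sub>R y \<in> S" using t(2) interior_subset by blast
  then have "N ((1 + t) *\<^sub>R y) \<le> b" using assms(2) by (simp only: scaleR_left_distrib scaleR_one)
  then have "(1 + t) * N y \<le> b" using t(1) by (simp only: homogeneous abs_of_pos add_pos_pos zero_less_one)
  then have "N y + t * N y \<le> b" by (simp add: algebra_simps)
  then show ?thesis using mult_pos_pos[OF t(1) pos[OF False]] by linarith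
qed (use assms in simp)

lemma interior_facet_tiles_disjoint:
  assumes f: "f \<in> facet_functionals N" and g: "g \<in> facet_functionals N" and ne: "(f, n) \<noteq> (g, m)"
  shows "interior (facet_tile f n) \<inter> interior (facet_tile g m) = {}"
proof (rule ccontr)
  assume "\<not> ?thesis"
  then obtain y where y: "y \<in> interior (facet_tile f n)" "y \<in> interior (facet_tile g m)" by blast
  have sub: "interior (facet_tile h k) \<subseteq> facet_cone N h" for h k
    using interior_subset by (auto simp: facet_tile_def facet_cone_def)
  have "g y = N y" using y(2) sub by (auto simp: facet_cone_def)
  then have "g = f"
    using y(1) by (intro facet_functionals_eq[OF f open_interior _ sub facet_functional_le[OF g]]) auto
  have low: "real k + 1 \<le> N y" if "y \<in> interior (facet_tile h k)" for h k
    using that interior_subset by (auto simp: facet_tile_def)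
  have up: "N y < real k + 2" if "y \<in> interior (facet_tile h k)" for h k
    by (rule N_less_interior[OF that]) (simp_all add: facet_tile_def)
  have "real n + 1 < real m + 2" "real m + 1 < real n + 2"
    using low[OF y(1)] low[OF y(2)] up[OF y(1)] up[OF y(2)] by linarith+
  then have "n = m" by simp
  then show False using \<open>g = f\<close> ne by simp
qed

lemma interior_unit_ball_facet_tile_disjoint: "interior (unit_ball N) \<inter> interior (facet_tile f n) = {}"
proof -
  have False if y: "y \<in> interior (unit_ball N)" "y \<in> interior (facet_tile f n)" for y
  proof -
    have "N y < 1" by (rule N_less_interior[OF y(1)]) (simp_all add: unit_ball_def)
    moreover have "1 \<le> N y" using y(2) interior_subset by (force simp: facet_tile_def)
    ultimately show False by simp
  qed
  then show ?thesis by blast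
qed

text \<open>On a finite-dimensional subspace \<open>N\<close> is the maximum of a finite set \<open>G\<close>, and \<open>f x = N x\<close>
  becomes the system of inequalities \<open>g x \<le> f x\<close>.\<close>

lemma polytope_facet_tile:
  assumes N: "locally_finite_max N" and f: "f \<in> facet_functionals N" and V: "finite_dim_subspace V"
  shows "polytope (facet_tile f n \<inter> V)"
proof -
  obtain G :: "('a \<Rightarrow>\<^sub>L real) set" where G: "finite G" "\<And>f y. f \<in> G \<Longrightarrow> blinfun_apply f y \<le> N y"
    "\<And>y. y \<in> V \<Longrightarrow> \<exists>f\<in>G. blinfun_apply f y = N y"
    using finite_max_on_finite_dim[OF N V] by metis
  define I where "I = insert (f, real n + 2) (insert (- f, - (real n + 1)) ((\<lambda>g. (g - f, 0)) ` G))"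
  have "polytope {y \<in> V. \<forall>i\<in>I. blinfun_apply (fst i) y \<le> snd i}"
  proof (rule polytope_of_inequalities[OF _ _ linear_blinfun])
    show "subspace V" using V by (auto simp: finite_dim_subspace_def)
    show "finite I" using G(1) by (simp add: I_def)
    fix d assume d: "d \<in> V" "d \<noteq> 0"
    show "\<exists>i\<in>I. 0 < blinfun_apply (fst i) d"
    proof (rule ccontr)
      assume no: "\<not> ?thesis"
      obtain g where g: "g \<in> G" "g d = N d" using G(3)[OF d(1)] by blast
      have "(g - f) d \<le> 0" "f d \<le> 0" using no g(1) by (force simp: I_def)+
      then show False using g(2) pos[OF d(2)] by (simp add: blinfun.diff_left)
    qed
  qed
  also have "{y \<in> V. \<forall>i\<in>I. blinfun_apply (fst i) y \<le> snd i} = facet_tile f n \<inter> V"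
  proof (intro set_eqI iffI)
    fix y assume y: "y \<in> {y \<in> V. \<forall>i\<in>I. blinfun_apply (fst i) y \<le> snd i}"
    then obtain g where g: "g \<in> G" "g y = N y" using G(3) by blast
    have "(g - f) y \<le> 0" using y g(1) by (force simp: I_def)
    then have "f y = N y" using g(2) facet_functional_le[OF f, of y] by (simp add: blinfun.diff_left)
    then show "y \<in> facet_tile f n \<inter> V" using y by (auto simp: I_def facet_tile_def blinfun.minus_left)
  next
    fix y assume "y \<in> facet_tile f n \<inter> V"
    then show "y \<in> {y \<in> V. \<forall>i\<in>I. blinfun_apply (fst i) y \<le> snd i}"
      using G(2) by (auto simp: I_def facet_tile_def blinfun.minus_left blinfun.diff_left)
  qed
  finally show ?thesis .
qed

lemma radial_tiling_is_tiling:
  assumes N: "locally_finite_max N" and a: "a \<noteq> (0 :: 'a)"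
  shows "tiling radial_tiling"
  unfolding tiling_def
proof (intro conjI ballI)
  fix C assume C: "C \<in> radial_tiling"
  show "convex_body C"
  proof (cases "C = unit_ball N")
    case True
    have "closed (unit_ball N)" "convex (unit_ball N)"
      unfolding unit_ball_def by (auto intro!: closed_Collect_le continuous convex_N_le)
    moreover have "{y. N y < 1} \<subseteq> interior (unit_ball N)"
      by (rule interior_maximal[OF _ open_less]) (auto simp: unit_ball_def)
    then have "0 \<in> interior (unit_ball N)" by auto
    ultimately show ?thesis using True by (auto simp: convex_body_def)
  next
    case False
    then obtain f n where "f \<in> facet_functionals N" "C = facet_tile f n"
      using C by (auto simp: radial_tiling_def)
    then show ?thesis
      using closed_facet_tile convex_facet_tile interior_facet_tile[OF _ a] by (simp add: convex_body_def)
  qed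
next
  have "x \<in> \<Union>radial_tiling" for x
  proof (cases "N x \<le> 1")
    case True
    then show ?thesis by (auto simp: radial_tiling_def unit_ball_def)
  next
    case False
    then have "x \<noteq> 0" by auto
    then obtain F U where "F \<subseteq> facet_functionals N" "x \<in> U"
      "\<And>y. y \<in> U \<Longrightarrow> \<exists>f\<in>F. blinfun_apply f y = N y"
      using locally_max_of_facet_functionals[OF N] by metis
    then obtain f where f: "f \<in> facet_functionals N" "f x = N x" by blast
    define n where "n = nat \<lfloor>N x - 1\<rfloor>"
    have "real n + 1 \<le> N x" "N x \<le> real n + 2"
      using False unfolding n_def by linarith+
    then have "x \<in> facet_tile f n" using f(2) by (simp add: facet_tile_def)
    then show ?thesis using f(1) by (auto simp: radial_tiling_def)
  qed
  then show "\<Union>radial_tiling = UNIV" by blast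
next
  show "pairwise (\<lambda>C D. interior C \<inter> interior D = {}) radial_tiling"
  proof (rule pairwiseI)
    fix C D assume C: "C \<in> radial_tiling" and D: "D \<in> radial_tiling" and "C \<noteq> D"
    show "interior C \<inter> interior D = {}"
    proof (cases "C = unit_ball N \<or> D = unit_ball N")
      case True
      then show ?thesis
        using C D \<open>C \<noteq> D\<close> interior_unit_ball_facet_tile_disjoint by (auto simp: radial_tiling_def)
    next
      case False
      then obtain f n g m where "f \<in> facet_functionals N" "C = facet_tile f n"
        "g \<in> facet_functionals N" "D = facet_tile g m"
        using C D by (auto simp: radial_tiling_def)
      then show ?thesis using interior_facet_tiles_disjoint[of f g n m] \<open>C \<noteq> D\<close> by blast
    qed
  qed
qed

text \<open>Near a point \<open>x\<close> outside the open ball only the facet functionals of one finite set have cones that come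
  close, and boundedness of \<open>N\<close> leaves finitely many of the pieces of each cone.\<close>

lemma radial_tiling_locally_finite:
  assumes N: "locally_finite_max N"
  shows "locally_finite_in euclidean radial_tiling"
  unfolding locally_finite_in_def
proof (intro conjI ballI)
  fix x :: 'a
  have "\<exists>V. open V \<and> x \<in> V \<and> finite {C \<in> radial_tiling. C \<inter> V \<noteq> {}}"
  proof (cases "N x < 1")
    case True
    have "{C \<in> radial_tiling. C \<inter> {y. N y < 1} \<noteq> {}} \<subseteq> {unit_ball N}"
      by (auto simp: radial_tiling_def facet_tile_def)
    then have "finite {C \<in> radial_tiling. C \<inter> {y. N y < 1} \<noteq> {}}" using finite_subset by blast
    then show ?thesis using True open_less by blast
  next
    case False
    then have "x \<noteq> 0" by auto
    then obtain F U where F: "finite F" "open U" "x \<in> U"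
      "\<And>f. f \<in> facet_functionals N \<Longrightarrow> facet_cone N f \<inter> U \<noteq> {} \<Longrightarrow> f \<in> F"
      using locally_max_of_facet_functionals[OF N] by metis
    obtain k :: nat where k: "N x + 1 < real k" using reals_Archimedean2 by blast
    let ?V = "U \<inter> {y. N y < N x + 1}"
    have "{C \<in> radial_tiling. C \<inter> ?V \<noteq> {}} \<subseteq> insert (unit_ball N) ((\<lambda>(f, n). facet_tile f n) ` (F \<times> {..<k}))"
    proof
      fix C assume C: "C \<in> {C \<in> radial_tiling. C \<inter> ?V \<noteq> {}}"
      show "C \<in> insert (unit_ball N) ((\<lambda>(f, n). facet_tile f n) ` (F \<times> {..<k}))"
      proof (cases "C = unit_ball N")
        case False
        then obtain f n where f: "f \<in> facet_functionals N" "C = facet_tile f n"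
          using C by (auto simp: radial_tiling_def)
        obtain y where y: "y \<in> facet_tile f n" "y \<in> U" "N y < N x + 1" using C f(2) by blast
        have "f \<in> F" using y F(4)[OF f(1)] by (auto simp: facet_tile_def facet_cone_def)
        moreover have "n < k" using y k by (simp add: facet_tile_def)
        ultimately show ?thesis using f(2) by auto
      qed simp
    qed
    then have "finite {C \<in> radial_tiling. C \<inter> ?V \<noteq> {}}"
      by (rule finite_subset) (use F(1) in simp)
    moreover have "open ?V" using F(2) open_less by blast
    ultimately show ?thesis using F(3) by (intro exI[of _ ?V]) simp
  qed
  then show "\<exists>V. openin euclidean V \<and> x \<in> V \<and> finite {C \<in> radial_tiling. C \<inter> V \<noteq> {}}"
    by (simp add: open_openin[symmetric])
qed simp

theorem symmetric_polytope_radial_tiling: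
  assumes N: "locally_finite_max N" and a: "a \<noteq> (0 :: 'a)"
  shows "symmetric_polytope_tiling radial_tiling"
  unfolding symmetric_polytope_tiling_def locally_finite_tiling_def
proof (intro conjI ballI)
  show "tiling radial_tiling" by (rule radial_tiling_is_tiling[OF N a])
  show "locally_finite_in euclidean radial_tiling" by (rule radial_tiling_locally_finite[OF N])
  have "uminus ` unit_ball N = unit_ball N"
  proof -
    have "- x \<in> unit_ball N" if "x \<in> unit_ball N" for x
      using that homogeneous[of "-1" x] by (simp add: unit_ball_def)
    then have "uminus ` unit_ball N \<subseteq> unit_ball N" by blast
    moreover from this have "uminus ` uminus ` unit_ball N \<subseteq> uminus ` unit_ball N" by (rule image_mono)
    ultimately show ?thesis by (simp add: image_image)
  qed
  then show "\<exists>C\<in>radial_tiling. uminus ` C = C" by (auto simp: radial_tiling_def)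
  fix C assume C: "C \<in> radial_tiling"
  then have body: "closed C" "convex C"
    using radial_tiling_is_tiling[OF N a] by (auto simp: tiling_def convex_body_def)
  show "normed_polytope C"
  proof (cases "C = unit_ball N")
    case True
    have "bounded C" using bounded_N_le[of 1] True by (simp add: unit_ball_def)
    then show ?thesis
      using body locally_finite_max_imp_K[OF N] True by (simp add: normed_polytope_def K_polyhedral_def)
  next
    case False
    then obtain f n where f: "f \<in> facet_functionals N" "C = facet_tile f n"
      using C by (auto simp: radial_tiling_def)
    have "bounded C"
      by (rule bounded_subset[OF bounded_N_le[of "real n + 2"]]) (auto simp: f facet_tile_def)
    then show ?thesis using body polytope_facet_tile[OF N f(1)] f(2) by (simp add: normed_polytope_def)
  qed
qed

text \<open>If finitely many functionals sufficed, a finite-rank projection preserving all of them would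
  be the identity.\<close>

lemma infinite_facet_functionals:
  assumes N: "locally_finite_max N" and a: "a \<noteq> (0 :: 'a)" and inf: "\<not> finite_dim_subspace (UNIV :: 'a set)"
  shows "infinite (facet_functionals N)"
proof
  assume fin: "finite (facet_functionals N)"
  obtain P B where P: "finite B" "projection_onto P (span B)"
    "\<And>f y. f \<in> facet_functionals N \<Longrightarrow> blinfun_apply f (P y) = blinfun_apply f y"
    using projection_preserving_functionals[OF fin a] by blast
  have "y \<in> span B" for y
  proof -
    have "y - P y = 0"
    proof (rule ccontr)
      assume ne: "y - P y \<noteq> 0"
      obtain F U where "F \<subseteq> facet_functionals N" "y - P y \<in> U"
        "\<And>y. y \<in> U \<Longrightarrow> \<exists>f\<in>F. blinfun_apply f y = N y"
        using locally_max_of_facet_functionals[OF N ne] by metis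
      then obtain f where "f \<in> facet_functionals N" "f (y - P y) = N (y - P y)" by blast
      then show False using P(3)[of f y] pos[OF ne] by (simp add: blinfun.diff_right)
    qed
    then show ?thesis using P(2) by (metis eq_iff_diff_eq_0 projection_onto_def)
  qed
  then have "UNIV = span B" by blast
  then show False using inf P(1) unfolding finite_dim_subspace_def by blast
qed

text \<open>Each facet functional contributes countably many tiles, which does not change an infinite
  cardinality.\<close>

theorem radial_tiling_eqpoll:
  assumes a: "a \<noteq> (0 :: 'a)" and inf: "infinite (facet_functionals N)"
  shows "eqpoll radial_tiling (facet_functionals N)"
proof (rule lepoll_antisym)
  let ?\<Phi> = "facet_functionals N"
  have "?\<Phi> \<times> (UNIV :: nat set) \<lesssim> ?\<Phi> \<times> ?\<Phi>"
    using inf by (intro times_lepoll_mono) (auto simp: infinite_le_lepoll)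
  also have "?\<Phi> \<times> ?\<Phi> \<approx> ?\<Phi>"
    using card_of_Times_same_infinite[OF inf] by (simp add: eqpoll_iff_card_of_ordIso)
  finally have *: "?\<Phi> \<times> (UNIV :: nat set) \<lesssim> ?\<Phi>" .
  have "radial_tiling \<lesssim> insert None (Some ` (?\<Phi> \<times> (UNIV :: nat set)))"
    unfolding lepoll_iff
    by (rule exI[of _ "\<lambda>p. case p of None \<Rightarrow> unit_ball N | Some (f, n) \<Rightarrow> facet_tile f n"])
      (force simp: radial_tiling_def)
  also have "\<dots> \<lesssim> Some ` (?\<Phi> \<times> (UNIV :: nat set))"
    using inf by (intro infinite_insert_lepoll) (auto simp: finite_cartesian_product_iff finite_image_iff)
  also have "\<dots> \<lesssim> ?\<Phi> \<times> (UNIV :: nat set)" by (rule image_lepoll)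
  finally show "radial_tiling \<lesssim> ?\<Phi>" using * lepoll_trans by blast
  have "inj_on (\<lambda>f. facet_tile f 0) ?\<Phi>"
  proof (rule inj_onI, rule ccontr)
    fix f g assume "f \<in> ?\<Phi>" "g \<in> ?\<Phi>" "facet_tile f 0 = facet_tile g 0" "f \<noteq> g"
    then show False
      using interior_facet_tiles_disjoint[of f g 0 0] interior_facet_tile[OF _ a, of f 0] by simp
  qed
  then show "?\<Phi> \<lesssim> radial_tiling" unfolding lepoll_def
    by (intro exI[of _ "\<lambda>f. facet_tile f 0"]) (auto simp: radial_tiling_def)
qed

end

text \<open>The zero space is separate because there the shells of the radial tiling are empty and so are
  not convex bodies.\<close>

lemma zero_space_tiling:
  assumes "\<And>x :: 'a::real_normed_vector. x = 0"
  shows "symmetric_polytope_tiling {UNIV :: 'a set}"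
proof -
  have UNIV: "(UNIV :: 'a set) = {0}" using assms by auto
  have poly: "polytope (UNIV \<inter> V :: 'a set)" for V
  proof -
    have "V = {} \<or> V = {0}" using subset_singletonD[of V 0] UNIV by blast
    then show ?thesis by (auto simp: polytope_empty polytope_sing)
  qed
  have "bounded (UNIV :: 'a set)" unfolding UNIV by simp
  then have "normed_polytope (UNIV :: 'a set)" using poly by (simp only: normed_polytope_def) simp
  moreover have "tiling {UNIV :: 'a set}" by (simp add: tiling_def convex_body_def)
  moreover have "locally_finite_in euclidean {UNIV :: 'a set}"
    by (rule finite_imp_locally_finite_in) simp_all
  moreover have "uminus ` (UNIV :: 'a set) = UNIV" by (simp add: UNIV)
  ultimately show ?thesis
    unfolding symmetric_polytope_tiling_def locally_finite_tiling_def by blast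
qed

lemma symmetric_polytope_tiling_exists:
  fixes N :: "'a::real_normed_vector \<Rightarrow> real"
  assumes "equivalent_norm N" "locally_finite_max N"
  shows "\<exists>T :: 'a set set. symmetric_polytope_tiling T"
proof (cases "\<exists>a :: 'a. a \<noteq> 0")
  case True
  interpret renorming N by (rule renorming.intro[OF assms(1)])
  show ?thesis using symmetric_polytope_radial_tiling[OF assms(2)] True by blast
next
  case False
  then show ?thesis using zero_space_tiling by blast
qed

section \<open>The equivalences\<close>

theorem theorem4p6:
  shows "((\<exists>T :: 'a::real_normed_vector set set. locally_finite_tiling T \<and> (\<forall>C\<in>T. bounded C))
            \<longleftrightarrow> (\<exists>N :: 'a \<Rightarrow> real. equivalent_norm N \<and> VI_polyhedral N \<and> property_Delta N))
       \<and> ((\<exists>N :: 'a \<Rightarrow> real. equivalent_norm N \<and> VI_polyhedral N \<and> property_Delta N)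
            \<longleftrightarrow> (\<exists>N :: 'a \<Rightarrow> real. equivalent_norm N \<and> K_polyhedral N \<and> LFC N))
       \<and> ((\<exists>T :: 'a set set. locally_finite_tiling T \<and> (\<forall>C\<in>T. bounded C))
            \<longrightarrow> (\<exists>T :: 'a set set. symmetric_polytope_tiling T))
       \<and> (\<forall>N :: 'a \<Rightarrow> real.
            \<not> finite_dim_subspace (UNIV :: 'a set) \<and>
            equivalent_norm N \<and> VI_polyhedral N \<and> property_Delta N
            \<longrightarrow> (\<exists>T :: 'a set set. symmetric_polytope_tiling T \<and> eqpoll T (minimal_boundary N)))"
    (is "(?A \<longleftrightarrow> ?B) \<and> (?B \<longleftrightarrow> ?C) \<and> (?A \<longrightarrow> ?S) \<and> ?Card")
proof -
  let ?L = "\<exists>N :: 'a \<Rightarrow> real. equivalent_norm N \<and> locally_finite_max N"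
  have B: "?B \<longleftrightarrow> ?L"
    using renorming.VI_Delta_imp_locally_finite_max renorming.locally_finite_max_imp_VI
      renorming.locally_finite_max_imp_Delta renorming.intro by metis
  have C: "?C \<longleftrightarrow> ?L"
    using renorming.K_LFC_imp_locally_finite_max renorming.locally_finite_max_imp_K
      renorming.locally_finite_max_imp_LFC renorming.intro by metis
  have A: "?A \<Longrightarrow> ?L" using bounded_tiling_imp_norm by metis
  have S: "?L \<Longrightarrow> ?S" using symmetric_polytope_tiling_exists by blast
  have SA: "?S \<Longrightarrow> ?A" unfolding symmetric_polytope_tiling_def normed_polytope_def by blast
  have ?Card
  proof (intro allI impI, elim conjE)
    fix N :: "'a \<Rightarrow> real"
    assume inf: "\<not> finite_dim_subspace (UNIV :: 'a set)" and N: "equivalent_norm N" "VI_polyhedral N" "property_Delta N"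
    interpret renorming N by (rule renorming.intro[OF N(1)])
    have lfm: "locally_finite_max N" by (rule VI_Delta_imp_locally_finite_max[OF N(2,3)])
    obtain a :: 'a where a: "a \<noteq> 0"
    proof (rule ccontr)
      assume "\<not> thesis"
      then have "(UNIV :: 'a set) = span {}" using that by auto
      then show False using inf unfolding finite_dim_subspace_def by blast
    qed
    have "eqpoll radial_tiling (minimal_boundary N)"
      using radial_tiling_eqpoll[OF a infinite_facet_functionals[OF lfm a inf]]
      by (simp add: minimal_boundary_eq[OF lfm a])
    then show "\<exists>T :: 'a set set. symmetric_polytope_tiling T \<and> eqpoll T (minimal_boundary N)"
      using symmetric_polytope_radial_tiling[OF lfm a] by blast
  qed
  moreover have "?A \<longleftrightarrow> ?B" "?B \<longleftrightarrow> ?C" "?A \<longrightarrow> ?S" using A B C S SA by blast+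
  ultimately show ?thesis by blast
qed

end
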